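(* Let $X \subseteq \mathbb{R}$ be a non-empty open interval. (i) Let $F : [0,\infty) \to \mathbb{R}$. The map $K \mapsto F \circ K$ sends the set of continuous totally non-negative Hankel kernels on $X \times X$ to itself if and only if $F(0) \geq 0$ and there exist constants $c_k \geq 0$ ($k \geq 0$) such that $F(x) = \sum_{k=0}^\infty c_k x^k$ for all $x \in (0,\infty)$. (ii) Let $F : (0,\infty) \to \mathbb{R}$. The map $K \mapsto F \circ K$ sends the set of continuous totally positive Hankel kernels on $X \times X$ to itself if and only if $F$ is non-constant and there exist constants $c_k \geq 0$ ($k \geq 0$) such that $F(x) = \sum_{k=0}^\infty c_k x^k$ for all $x \in (0,\infty)$.
   Context: A Hankel kernel on $X \times X$ is a function $K : X \times X \to \mathbb{R}$ of the form $K(x,y) = f(x+y)$ for some $f : X + X \to \mathbb{R}$. A kernel $K : X \times X \to \mathbb{R}$ is totally non-negative (respectively totally positive) if for every $n \in \mathbb{N}$ and all $x_1 < \cdots < x_n$ and $y_1 < \cdots < y_n$ in $X$ the determinant of $(K(x_i,y_j))_{i,j=1}^n$ is $\geq 0$ (respectively $> 0$). *)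

theory Defs
  imports "HOL-Analysis.Analysis" "Jordan_Normal_Form.Determinant"
begin

text \<open>
  A kernel on \<open>X \<times> X\<close> is represented by a total function on \<open>real \<times> real\<close>. All predicates below
  only depend on its values on \<open>X \<times> X\<close>, so the extension to the plane is immaterial.
\<close>

definition hankel_kernel :: "real set \<Rightarrow> (real \<times> real \<Rightarrow> real) \<Rightarrow> bool" where
  "hankel_kernel X K \<longleftrightarrow> (\<exists>f :: real \<Rightarrow> real. \<forall>x\<in>X. \<forall>y\<in>X. K (x, y) = f (x + y))"

text \<open>
  The points \<open>x\<^sub>1 < \<dots> < x\<^sub>n\<close> are \<open>xs 0 < \<dots> < xs (n - 1)\<close>. The case \<open>n = 0\<close> is harmless, as the
  empty determinant is \<open>1\<close>. The case \<open>n = 1\<close> shows that a totally non-negative (totally positive)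
  kernel takes values in \<open>[0, \<infinity>)\<close> (in \<open>(0, \<infinity>)\<close>) on \<open>X \<times> X\<close>.
\<close>

definition totally_nonnegative :: "real set \<Rightarrow> (real \<times> real \<Rightarrow> real) \<Rightarrow> bool" where
  "totally_nonnegative X K \<longleftrightarrow>
    (\<forall>(n::nat) (xs :: nat \<Rightarrow> real) (ys :: nat \<Rightarrow> real).
      xs \<in> {..<n} \<rightarrow> X \<longrightarrow> ys \<in> {..<n} \<rightarrow> X \<longrightarrow>
      strict_mono_on {..<n} xs \<longrightarrow> strict_mono_on {..<n} ys \<longrightarrow>
      Determinant.det (Matrix.mat n n (\<lambda>(i, j). K (xs i, ys j))) \<ge> 0)"

definition totally_positive :: "real set \<Rightarrow> (real \<times> real \<Rightarrow> real) \<Rightarrow> bool" where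
  "totally_positive X K \<longleftrightarrow>
    (\<forall>(n::nat) (xs :: nat \<Rightarrow> real) (ys :: nat \<Rightarrow> real).
      xs \<in> {..<n} \<rightarrow> X \<longrightarrow> ys \<in> {..<n} \<rightarrow> X \<longrightarrow>
      strict_mono_on {..<n} xs \<longrightarrow> strict_mono_on {..<n} ys \<longrightarrow>
      Determinant.det (Matrix.mat n n (\<lambda>(i, j). K (xs i, ys j))) > 0)"

definition cont_TN_hankel_kernels :: "real set \<Rightarrow> (real \<times> real \<Rightarrow> real) set" where
  "cont_TN_hankel_kernels X =
    {K. continuous_on (X \<times> X) K \<and> hankel_kernel X K \<and> totally_nonnegative X K}"

definition cont_TP_hankel_kernels :: "real set \<Rightarrow> (real \<times> real \<Rightarrow> real) set" where
  "cont_TP_hankel_kernels X =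
    {K. continuous_on (X \<times> X) K \<and> hankel_kernel X K \<and> totally_positive X K}"

end

theory Submission
  imports Defs "HOL-Library.Diagonal_Subsequence"
begin

text \<open>
  A continuous Hankel kernel on an open interval is totally non-negative (totally positive) iff its
  quadratic forms \<open>\<Sum> c\<^sub>i c\<^sub>j K(x\<^sub>i, x\<^sub>j)\<close> are non-negative (positive for \<open>c \<noteq> 0\<close>). Indeed, on a grid all
  contiguous minors of a Hankel kernel are principal minors, so Fekete's criterion makes all minors
  with rational points positive if the forms are positive definite; continuity gives non-negativity
  for real points, and a vanishing minor could be moved to rational points. The semidefinite case
  follows by adding a small multiple of the Gaussian kernel \<open>exp ((x + y)\<^sup>2 / 2)\<close>. Since quadratic forms
  behave well under sums and, by Schur, under products, power series with non-negative coefficients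
  preserve both classes.

  Conversely, a transform preserving positivity of the kernels \<open>a + exp (u (x + y)) + \<epsilon> exp ((x + y)\<^sup>2 / 2)\<close>
  is continuous and makes \<open>F(a + v\<^sub>i v\<^sub>j)\<close> positive semidefinite. This property survives the iterated
  integration over windows of length \<open>h\<close>, after which \<open>F\<close> is smooth enough for a Taylor expansion at
  \<open>v \<rightarrow> 0\<close>; it shows that all forward differences of \<open>F\<close> are non-negative. Hence the Bernstein
  polynomials of \<open>F\<close> have non-negative coefficients, and a limit of them is the power series.
\<close>


section \<open>Minors of function-valued matrices\<close>

text \<open>The three-term identity is used twice: read forwards it drives Fekete's induction, read
  backwards it spreads a zero of a minor, which recovers the strictness lost in the limit to real
  points. In the converse the constant \<open>a\<close> matters: exponentials alone only give the
  matrices \<open>F (v i * v j)\<close>, and these are positive semidefinite for fractional powers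
  \<open>F\<close> as well. The value \<open>F 0\<close> stays independent of the series because a
  continuous totally non-negative Hankel kernel whose diagonal has a zero vanishes
  identically.\<close>

definition fdet :: "nat \<Rightarrow> (nat \<Rightarrow> nat \<Rightarrow> real) \<Rightarrow> real" where
  "fdet n A = Determinant.det (Matrix.mat n n (\<lambda>(i, j). A i j))"

lemma fdet_cong:
  assumes "\<And>i j. i < n \<Longrightarrow> j < n \<Longrightarrow> A i j = B i j"
  shows "fdet n A = fdet n B"
  unfolding fdet_def by (rule arg_cong[where f = Determinant.det]) (auto intro!: eq_matI simp: assms)

lemma fdet_0 [simp]: "fdet 0 A = 1"
  by (simp add: fdet_def)

lemma fdet_1: "fdet (Suc 0) A = A 0 0"
  unfolding fdet_def by (subst det_single) auto

lemma fdet_transpose: "fdet n (\<lambda>i j. A j i) = fdet n A"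
proof -
  have "Matrix.mat n n (\<lambda>(i, j). A j i) = transpose_mat (Matrix.mat n n (\<lambda>(i, j). A i j))"
    by (auto intro!: eq_matI)
  then show ?thesis
    unfolding fdet_def using det_transpose[of "Matrix.mat n n (\<lambda>(i, j). A i j)" n] by simp
qed

lemma fdet_permutations:
  "fdet n A = (\<Sum>p | p permutes {0..<n}. signof p * (\<Prod>i = 0..<n. A i (p i)))"
  unfolding fdet_def
  by (subst det_def'[of _ n]) (auto intro!: sum.cong prod.cong simp: permutes_def)

lemma fdet_tendsto:
  assumes "\<And>i j. i < n \<Longrightarrow> j < n \<Longrightarrow> ((\<lambda>m. A m i j) \<longlongrightarrow> B i j) F"
  shows "((\<lambda>m. fdet n (A m)) \<longlongrightarrow> fdet n B) F"
  unfolding fdet_permutations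
  by (intro tendsto_sum tendsto_mult tendsto_const tendsto_prod assms) (use permutes_in_image in \<open>fastforce+\<close>)

lemma fdet_laplace_row:
  assumes "k < Suc n"
  shows "fdet (Suc n) A =
    (\<Sum>j<Suc n. (-1)^(k + j) * A k j * fdet n (\<lambda>i' j'. A (insert_index k i') (insert_index j j')))"
proof -
  have "mat_delete (Matrix.mat (Suc n) (Suc n) (\<lambda>(i, j). A i j)) k j
      = Matrix.mat n n (\<lambda>(i', j'). A (insert_index k i') (insert_index j j'))" for j
    unfolding mat_delete_def insert_index_def by (auto intro!: eq_matI)
  then show ?thesis
    unfolding fdet_def
    by (subst laplace_expansion_row[OF _ assms]) (auto intro!: sum.cong simp: cofactor_def assms)
qed

lemma fdet_laplace_column:
  assumes "k < Suc n"
  shows "fdet (Suc n) A =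
    (\<Sum>i<Suc n. (-1)^(i + k) * A i k * fdet n (\<lambda>i' j'. A (insert_index i i') (insert_index k j')))"
proof -
  have "fdet (Suc n) A = fdet (Suc n) (\<lambda>i j. A j i)"
    by (rule fdet_transpose[symmetric])
  also have "\<dots> = (\<Sum>i<Suc n. (-1)^(i + k) * A i k * fdet n (\<lambda>j' i'. A (insert_index i i') (insert_index k j')))"
    by (subst fdet_laplace_row[OF assms]) (simp add: add.commute)
  also have "\<dots> = (\<Sum>i<Suc n. (-1)^(i + k) * A i k * fdet n (\<lambda>i' j'. A (insert_index i i') (insert_index k j')))"
    by (intro sum.cong refl arg_cong2[where f = "(*)"]) (rule fdet_transpose)
  finally show ?thesis .
qed

lemma fdet_identical_rows:
  assumes "i < n" "k < n" "i \<noteq> k" "\<And>j. j < n \<Longrightarrow> A i j = A k j"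
  shows "fdet n A = 0"
  unfolding fdet_def
  by (rule det_identical_rows[of _ n i k]) (use assms in \<open>auto intro!: eq_vecI\<close>)

lemma fdet_identical_columns:
  assumes "j < n" "k < n" "j \<noteq> k" "\<And>i. i < n \<Longrightarrow> A i j = A i k"
  shows "fdet n A = 0"
  by (subst fdet_transpose[symmetric], rule fdet_identical_rows[of j n k]) (use assms in auto)

lemma fdet_eq_0_iff:
  "fdet n A = 0 \<longleftrightarrow> (\<exists>c. (\<exists>j<n. c j \<noteq> 0) \<and> (\<forall>i<n. (\<Sum>j<n. A i j * c j) = 0))"
proof -
  let ?M = "Matrix.mat n n (\<lambda>(i, j). A i j)"
  have mul: "vec_index (?M *\<^sub>v v) i = (\<Sum>j<n. A i j * vec_index v j)" if "v \<in> carrier_vec n" "i < n" for v i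
    using that by (auto simp: scalar_prod_def lessThan_atLeast0 intro!: sum.cong)
  have "fdet n A = 0 \<longleftrightarrow> (\<exists>v. v \<in> carrier_vec n \<and> v \<noteq> 0\<^sub>v n \<and> ?M *\<^sub>v v = 0\<^sub>v n)"
    unfolding fdet_def by (rule det_0_iff_vec_prod_zero) simp
  also have "\<dots> \<longleftrightarrow> (\<exists>c. (\<exists>j<n. c j \<noteq> 0) \<and> (\<forall>i<n. (\<Sum>j<n. A i j * c j) = 0))"
  proof
    assume "\<exists>v. v \<in> carrier_vec n \<and> v \<noteq> 0\<^sub>v n \<and> ?M *\<^sub>v v = 0\<^sub>v n"
    then obtain v where v: "v \<in> carrier_vec n" "v \<noteq> 0\<^sub>v n" "?M *\<^sub>v v = 0\<^sub>v n"
      by blast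
    then have "\<exists>j<n. vec_index v j \<noteq> 0"
      by (metis carrier_vecD eq_vecI index_zero_vec(1) index_zero_vec(2))
    moreover have "\<forall>i<n. (\<Sum>j<n. A i j * vec_index v j) = 0"
      using mul[OF v(1)] v(3) by simp
    ultimately show "\<exists>c. (\<exists>j<n. c j \<noteq> 0) \<and> (\<forall>i<n. (\<Sum>j<n. A i j * c j) = 0)"
      by blast
  next
    assume "\<exists>c. (\<exists>j<n. c j \<noteq> 0) \<and> (\<forall>i<n. (\<Sum>j<n. A i j * c j) = 0)"
    then obtain c where c: "\<exists>j<n. c j \<noteq> 0" "\<forall>i<n. (\<Sum>j<n. A i j * c j) = 0"
      by blast
    define v where "v = Matrix.vec n c"
    have "v \<in> carrier_vec n"
      by (simp add: v_def)
    moreover have "v \<noteq> 0\<^sub>v n"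
      using c(1) by (metis index_vec index_zero_vec(1) v_def)
    moreover have "?M *\<^sub>v v = 0\<^sub>v n"
    proof (rule eq_vecI)
      show "vec_index (?M *\<^sub>v v) i = vec_index (0\<^sub>v n) i" if "i < dim_vec (0\<^sub>v n :: real Matrix.vec)" for i
        using mul[of v i] that c(2) by (simp add: v_def)
    qed simp
    ultimately show "\<exists>v. v \<in> carrier_vec n \<and> v \<noteq> 0\<^sub>v n \<and> ?M *\<^sub>v v = 0\<^sub>v n"
      by blast
  qed
  finally show ?thesis .
qed

text \<open>Append a copy of column \<open>j\<close> to the \<open>Suc n\<close> by \<open>n\<close>
  matrix \<open>M\<close>. The result is singular, and its expansion along the new column is the
  claim: the signed maximal minors annihilate every column of \<open>M\<close>.\<close>

lemma fdet_row_deletion_relation: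
  assumes "j < n"
  shows "(\<Sum>i<Suc n. (-1)^i * M i j * fdet n (\<lambda>i' j'. M (insert_index i i') j')) = 0"
proof -
  define N where "N = (\<lambda>i j'. if j' < n then M i j' else M i j)"
  have "0 = fdet (Suc n) N"
    by (rule fdet_identical_columns[of j _ n, symmetric]) (use assms in \<open>auto simp: N_def\<close>)
  also have "\<dots> = (\<Sum>i<Suc n. (-1)^(i + n) * N i n * fdet n (\<lambda>i' j'. N (insert_index i i') (insert_index n j')))"
    by (rule fdet_laplace_column) simp
  also have "\<dots> = (\<Sum>i<Suc n. (-1)^n * ((-1)^i * M i j * fdet n (\<lambda>i' j'. M (insert_index i i') j')))"
    by (intro sum.cong refl)
      (auto simp: N_def power_add mult_ac intro!: fdet_cong)
  also have "\<dots> = (-1)^n * (\<Sum>i<Suc n. (-1)^i * M i j * fdet n (\<lambda>i' j'. M (insert_index i i') j'))"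
    by (simp only: sum_distrib_left)
  finally show ?thesis by simp
qed

lemma delete_index_neq: "b < c \<Longrightarrow> i \<noteq> b \<Longrightarrow> i \<noteq> c \<Longrightarrow> delete_index c i \<noteq> b"
  by (auto simp: delete_index_def)

lemma delete_index_less: "i \<noteq> c \<Longrightarrow> c \<le> k \<Longrightarrow> i \<le> k \<Longrightarrow> delete_index c i < k"
  by (auto simp: delete_index_def)

text \<open>The functional \<open>G\<close> sends row \<open>i\<close> to its determinant with the
  rows other than \<open>a\<close>, \<open>b\<close>, \<open>c\<close> (in the first
  \<open>Suc m\<close> columns), so it vanishes on those other rows. Applied to the linear relation
  among the signed \<open>D i\<close> it leaves three terms. As \<open>b\<close> is the middle
  index, \<open>D b\<close> stands alone on one side and no minus sign remains, which is what
  positivity arguments need.\<close>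

lemma three_term_identity:
  fixes M :: "nat \<Rightarrow> nat \<Rightarrow> real"
  assumes abc: "a < b" "b < c" "c \<le> Suc (Suc m)"
  defines "D \<equiv> \<lambda>i. fdet (Suc (Suc m)) (\<lambda>i' j. M (insert_index i i') j)"
    and "E \<equiv> \<lambda>i k. fdet (Suc m) (\<lambda>i' j. M (insert_index k (insert_index i i')) j)"
  shows "D b * E a c = D a * E b c + D c * E a b"
proof -
  \<comment> \<open>The increasing enumeration of the \<open>m\<close> rows other than
    \<open>a\<close>, \<open>b\<close>, \<open>c\<close>; \<open>g\<close> collects their signed
    maximal minors.\<close>
  define r where "r = (\<lambda>i. insert_index c (insert_index b (insert_index a i)))"
  define g where "g = (\<lambda>j. (-1)^j * fdet m (\<lambda>i' j'. M (r i') (insert_index j j')))"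
  define G where "G = (\<lambda>i. \<Sum>j<Suc m. M i j * g j)"
  have sign_cancel: "(-1)^k * ((-1)^k * x) = x" for k :: nat and x :: real
    by (simp flip: mult.assoc power_mult_distrib)
  have E: "E i k = (-1)^p * G q"
    if "p < Suc m" and "\<And>i'. insert_index k (insert_index i (insert_index p i')) = r i'"
      and "insert_index k (insert_index i p) = q" for i k p q
    unfolding E_def
    by (subst fdet_laplace_row[OF that(1)])
      (simp add: that(2,3) G_def g_def sum_distrib_left power_add mult_ac del: sum.lessThan_Suc)
  \<comment> \<open>Expand along the one row among \<open>a\<close>, \<open>b\<close>,
    \<open>c\<close> that is kept. Its position is its index minus the number of smaller deleted
    rows: \<open>a\<close>, \<open>b - 1\<close>, \<open>c - 2\<close>. The odd shift at
    \<open>b\<close> supplies the sign of the identity.\<close>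
  have "E b c = (-1)^a * G a"
    by (rule E) (use abc in \<open>auto simp: r_def insert_index_def\<close>)
  moreover have "E a c = (-1)^(b - 1) * G b"
    by (rule E) (use abc in \<open>auto simp: r_def insert_index_def\<close>)
  moreover have "E a b = (-1)^(c - 2) * G c"
    by (rule E) (use abc in \<open>auto simp: r_def insert_index_def\<close>)
  moreover have "(-1)^(b - 1) = - ((-1)^b :: real)" "(-1)^(c - 2) = ((-1)^c :: real)"
    using abc by (auto simp: power_eq_if numeral_2_eq_2 split: if_splits)
  ultimately have EG: "G a = (-1)^a * E b c" "G b = - ((-1)^b * E a c)" "G c = (-1)^c * E a b"
    by (simp_all add: sign_cancel)
  have G0: "G i = 0" if i: "i \<le> Suc (Suc m)" "i \<noteq> a" "i \<noteq> b" "i \<noteq> c" for i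
  proof -
    \<comment> \<open>Undoing the three insertions, outermost first, gives the position
      \<open>i0\<close> of row \<open>i\<close> in the enumeration \<open>r\<close>; the matrix
      \<open>N\<close> below then contains row \<open>i\<close> twice.\<close>
    define i1 where "i1 = delete_index c i"
    define i2 where "i2 = delete_index b i1"
    define i0 where "i0 = delete_index a i2"
    have i1: "i1 \<noteq> a" "i1 \<noteq> b" "i1 < Suc (Suc m)"
      unfolding i1_def using i abc by (intro delete_index_neq delete_index_less; simp)+
    have i2: "i2 \<noteq> a" "i2 < Suc m"
      unfolding i2_def using i1 abc by (intro delete_index_neq delete_index_less; simp)+
    have i0: "r i0 = i" "i0 < m"
      unfolding r_def i0_def using i i1 i2 abc
      by (simp_all add: i2_def i1_def insert_delete_index delete_index_less)
    define N where "N = (\<lambda>k j. if k = 0 then M i j else M (r (k - 1)) j)"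
    have "G i = fdet (Suc m) N"
      by (subst fdet_laplace_row[of 0])
        (simp_all add: N_def G_def g_def mult_ac del: sum.lessThan_Suc)
    also have "\<dots> = 0"
      by (rule fdet_identical_rows[of 0 _ "Suc i0"]) (use i0 in \<open>auto simp: N_def\<close>)
    finally show ?thesis .
  qed
  have "0 = (\<Sum>j<Suc m. g j * (\<Sum>i<Suc (Suc (Suc m)). (-1)^i * M i j * D i))"
    unfolding D_def
    by (rule sum.neutral[symmetric])
      (use fdet_row_deletion_relation[of _ "Suc (Suc m)" M] in \<open>auto simp del: sum.lessThan_Suc\<close>)
  also have "\<dots> = (\<Sum>j<Suc m. \<Sum>i<Suc (Suc (Suc m)). (-1)^i * D i * (M i j * g j))"
    unfolding sum_distrib_left by (intro sum.cong refl) (simp only: mult_ac)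
  also have "\<dots> = (\<Sum>i<Suc (Suc (Suc m)). (-1)^i * D i * G i)"
    unfolding G_def sum_distrib_left by (rule sum.swap)
  also have "\<dots> = (\<Sum>i\<in>{a, b, c}. (-1)^i * D i * G i)"
    by (rule sum.mono_neutral_right) (use abc G0 in \<open>auto\<close>)
  also have "\<dots> = (-1)^a * D a * G a + (-1)^b * D b * G b + (-1)^c * D c * G c"
    using abc by simp
  also have "\<dots> = D a * E b c - D b * E a c + D c * E a b"
    unfolding EG by (simp add: sign_cancel mult.left_commute[of "D _"] mult.assoc)
  finally show ?thesis by linarith
qed

section \<open>Fekete's criterion and vanishing minors\<close>

lemma insert_index_less_Suc: "i' < n \<Longrightarrow> insert_index i i' < Suc n"
  by (auto simp: insert_index_def)

lemma strict_mono_on_insert_index: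
  assumes "strict_mono_on {..<Suc n} p"
  shows "strict_mono_on {..<n} (\<lambda>i'. p (insert_index i i'))"
  by (rule strict_mono_onI, rule strict_mono_onD[OF assms]) (auto simp: insert_index_def)

definition insert_at :: "nat \<Rightarrow> 'a \<Rightarrow> (nat \<Rightarrow> 'a) \<Rightarrow> nat \<Rightarrow> 'a" where
  "insert_at k r p = (\<lambda>i. if i < k then p i else if i = k then r else p (i - 1))"

lemma insert_at_insert_index [simp]: "insert_at k r p (insert_index k i) = p i"
  by (auto simp: insert_at_def insert_index_def)

lemma strict_mono_on_insert_at:
  fixes p :: "nat \<Rightarrow> 'a::linorder"
  assumes p: "strict_mono_on {..<n} p" and k: "0 < k" "k < n" "p (k - 1) < r" "r < p k"
  shows "strict_mono_on {..<Suc n} (insert_at k r p)"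
proof (rule strict_mono_onI)
  fix i j assume ij: "i \<in> {..<Suc n}" "j \<in> {..<Suc n}" "i < j"
  have le: "p i' \<le> p j'" if "i' \<le> j'" "j' < n" for i' j'
    using strict_mono_onD[OF p, of i' j'] that by (cases "i' = j'") auto
  consider "j < k" | "i < k" "j = k" | "i < k" "k < j" | "i = k" "k < j" | "k < i"
    using ij by linarith
  then show "insert_at k r p i < insert_at k r p j"
  proof cases
    case 1
    then show ?thesis
      using ij k by (auto simp: insert_at_def intro!: strict_mono_onD[OF p])
  next
    case 2
    moreover have "p i \<le> p (k - 1)"
      using 2 k by (intro le) auto
    ultimately show ?thesis
      using k by (auto simp: insert_at_def)
  next
    case 3
    then show ?thesis
      using ij k by (auto simp: insert_at_def intro!: strict_mono_onD[OF p])
  next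
    case 4
    moreover have "p k \<le> p (j - 1)"
      using 4 ij by (intro le) auto
    ultimately show ?thesis
      using k by (auto simp: insert_at_def)
  next
    case 5
    then show ?thesis
      using ij k by (auto simp: insert_at_def intro!: strict_mono_onD[OF p])
  qed
qed

lemma insert_at_Pi:
  assumes "p \<in> {..<n} \<rightarrow> I" "r \<in> I" "k < n"
  shows "insert_at k r p \<in> {..<Suc n} \<rightarrow> I"
  using assms by (auto simp: insert_at_def Pi_iff)

text \<open>The coefficients are minors of size \<open>n - 1\<close>, positive by
  \<open>low\<close>. Only their signs are kept: positivity of the outer minors passes to the middle
  one, and a zero of the middle one passes to non-negative outer ones.\<close>

lemma three_minors_relation:
  fixes B :: "'a::linorder \<Rightarrow> nat \<Rightarrow> real"
  assumes p: "strict_mono_on {..<Suc n} p" "p \<in> {..<Suc n} \<rightarrow> I"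
    and low: "\<And>p. strict_mono_on {..<n - 1} p \<Longrightarrow> p \<in> {..<n - 1} \<rightarrow> I
      \<Longrightarrow> fdet (n - 1) (\<lambda>i j. B (p i) j) > 0"
    and abc: "a < b" "b < c" "c \<le> n"
  defines "D \<equiv> \<lambda>i. fdet n (\<lambda>i' j. B (p (insert_index i i')) j)"
  shows "\<exists>\<alpha> \<beta> \<gamma>. \<alpha> > 0 \<and> \<beta> > 0 \<and> \<gamma> > 0 \<and> D b * \<beta> = D a * \<alpha> + D c * \<gamma>"
proof -
  obtain m where m: "n = Suc (Suc m)"
    using abc by (cases n; cases "n - 1") auto
  define E where "E = (\<lambda>i k. fdet (Suc m) (\<lambda>i' j. B (p (insert_index k (insert_index i i'))) j))"
  have E: "E i k > 0" for i k
  proof -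
    have "strict_mono_on {..<Suc m} (\<lambda>i'. p (insert_index k (insert_index i i')))"
      using strict_mono_on_insert_index[OF strict_mono_on_insert_index[of "Suc (Suc m)" p k], of i] p(1) m by simp
    moreover have "(\<lambda>i'. p (insert_index k (insert_index i i'))) \<in> {..<Suc m} \<rightarrow> I"
      using p(2) m by (auto simp: Pi_iff intro!: insert_index_less_Suc)
    ultimately show ?thesis
      using low[of "\<lambda>i'. p (insert_index k (insert_index i i'))"] m by (simp add: E_def)
  qed
  have "D b * E a c = D a * E b c + D c * E a b"
    using three_term_identity[OF abc(1,2), of m "\<lambda>i. B (p i)"] abc(3) by (simp add: D_def E_def m)
  then show ?thesis
    using E by blast
qed

text \<open>
  Fekete's criterion, one side at a time: inserting a point in the first gap of the row set
  expresses the minor through two minors of smaller dispersion.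
\<close>

lemma fekete_rows:
  fixes B :: "int \<Rightarrow> nat \<Rightarrow> real"
  assumes I: "\<And>a b c. a \<in> I \<Longrightarrow> c \<in> I \<Longrightarrow> a \<le> b \<Longrightarrow> b \<le> c \<Longrightarrow> b \<in> I"
    and contiguous: "\<And>p\<^sub>0. (\<And>i. i < n \<Longrightarrow> p\<^sub>0 + int i \<in> I) \<Longrightarrow> fdet n (\<lambda>i j. B (p\<^sub>0 + int i) j) > 0"
    and low: "\<And>p. strict_mono_on {..<n - 1} p \<Longrightarrow> p \<in> {..<n - 1} \<rightarrow> I
      \<Longrightarrow> fdet (n - 1) (\<lambda>i j. B (p i) j) > 0"
    and "strict_mono_on {..<n} p" "p \<in> {..<n} \<rightarrow> I"
  shows "fdet n (\<lambda>i j. B (p i) j) > 0"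
  using assms(4,5)
proof (induction "nat (p (n - 1) - p 0)" arbitrary: p rule: less_induct)
  case less
  note mono = less.prems(1) and pI = less.prems(2)
  show ?case
  proof (cases "\<forall>i<n. p i = p 0 + int i")
    case True
    then have "fdet n (\<lambda>i j. B (p i) j) = fdet n (\<lambda>i j. B (p 0 + int i) j)"
      by (intro fdet_cong) metis
    moreover have "p 0 + int i \<in> I" if "i < n" for i
      using True pI that by (metis PiE lessThan_iff)
    ultimately show ?thesis
      using contiguous[of "p 0"] by presburger
  next
    case False
    define k where "k = (LEAST i. i < n \<and> p i \<noteq> p 0 + int i)"
    have k: "k < n" "p k \<noteq> p 0 + int k"
      unfolding k_def using LeastI_ex[of "\<lambda>i. i < n \<and> p i \<noteq> p 0 + int i"] False by auto
    have before: "p i = p 0 + int i" if "i < k" for i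
      using not_less_Least[of i "\<lambda>i. i < n \<and> p i \<noteq> p 0 + int i"] that k by (auto simp: k_def)
    have k0: "0 < k"
      using k by (cases k) auto
    define r where "r = p 0 + int k"
    have r: "p (k - 1) < r" "r < p k"
    proof -
      show "p (k - 1) < r"
        using before[of "k - 1"] k0 by (simp add: r_def)
      have "p (k - 1) < p k"
        using strict_mono_onD[OF mono, of "k - 1" k] k k0 by auto
      then show "r < p k"
        using before[of "k - 1"] k0 k by (auto simp: r_def)
    qed
    \<comment> \<open>The point \<open>r\<close> is the smallest missing grid point. Dropping entry
      \<open>k\<close> of \<open>q\<close> returns \<open>p\<close>; dropping the first or the last
      entry leaves a smaller spread, so the induction hypothesis applies.\<close>
    have rI: "r \<in> I"
      by (rule I[of "p (k - 1)" "p k"]) (use pI k r in \<open>auto simp: Pi_iff\<close>)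
    define q where "q = insert_at k r p"
    have q: "strict_mono_on {..<Suc n} q" "q \<in> {..<Suc n} \<rightarrow> I"
      unfolding q_def using strict_mono_on_insert_at[OF mono k0 k(1) r] insert_at_Pi[OF pI rI k(1)] by auto
    have ends: "q 0 = p 0" "q n = p (n - 1)"
      using k0 k by (auto simp: q_def insert_at_def)
    have qlt: "q i < q j" if "i < j" "j \<le> n" for i j
      using strict_mono_onD[OF q(1), of i j] that by auto
    have q_deleted: "strict_mono_on {..<n} (\<lambda>i'. q (insert_index i i'))"
      "(\<lambda>i'. q (insert_index i i')) \<in> {..<n} \<rightarrow> I" for i
      using strict_mono_on_insert_index[OF q(1)] q(2) insert_index_less_Suc by blast+
    define D where "D = (\<lambda>i. fdet n (\<lambda>i' j. B (q (insert_index i i')) j))"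
    have "D 0 > 0"
      unfolding D_def
    proof (rule less.hyps)
      show "nat (q (insert_index 0 (n - 1)) - q (insert_index 0 0)) < nat (p (n - 1) - p 0)"
        using qlt[of 0 1] qlt[of 0 n] ends k k0 by (auto simp: insert_index_def)
    qed (rule q_deleted)+
    moreover have "D n > 0"
      unfolding D_def
    proof (rule less.hyps)
      show "nat (q (insert_index n (n - 1)) - q (insert_index n 0)) < nat (p (n - 1) - p 0)"
        using qlt[of "n - 1" n] qlt[of 0 n] ends k k0 by (auto simp: insert_index_def)
    qed (rule q_deleted)+
    moreover have "\<exists>\<alpha> \<beta> \<gamma>. \<alpha> > 0 \<and> \<beta> > 0 \<and> \<gamma> > 0 \<and> D k * \<beta> = D 0 * \<alpha> + D n * \<gamma>"
      unfolding D_def by (rule three_minors_relation[OF q low k0 k(1)]) auto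
    ultimately have "D k > 0"
      by (metis add_pos_pos mult_pos_pos zero_less_mult_pos2)
    then show ?thesis
      by (simp add: D_def q_def)
  qed
qed

text \<open>Two passes of \<open>fekete_rows\<close>: first the rows become arbitrary while the
  columns are contiguous, then the transposed problem is treated with these rows fixed. Induction on
  \<open>n\<close> supplies the positive smaller minors that each pass asks for.\<close>

lemma fekete:
  fixes A :: "int \<Rightarrow> int \<Rightarrow> real"
  assumes I: "\<And>a b c. a \<in> I \<Longrightarrow> c \<in> I \<Longrightarrow> a \<le> b \<Longrightarrow> b \<le> c \<Longrightarrow> b \<in> I"
    and contiguous: "\<And>n p\<^sub>0 q\<^sub>0. (\<And>i. i < n \<Longrightarrow> p\<^sub>0 + int i \<in> I) \<Longrightarrow> (\<And>i. i < n \<Longrightarrow> q\<^sub>0 + int i \<in> I)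
      \<Longrightarrow> fdet n (\<lambda>i j. A (p\<^sub>0 + int i) (q\<^sub>0 + int j)) > 0"
    and "strict_mono_on {..<n} p" "p \<in> {..<n} \<rightarrow> I"
    and "strict_mono_on {..<n} q" "q \<in> {..<n} \<rightarrow> I"
  shows "fdet n (\<lambda>i j. A (p i) (q j)) > 0"
  using assms(3-)
proof (induction n arbitrary: p q)
  case 0
  then show ?case by simp
next
  case (Suc n)
  have mono_less: "strict_mono_on {..<n} q'" if "strict_mono_on {..<Suc n} q'" for q' :: "nat \<Rightarrow> int"
    using that by (auto simp: strict_mono_on_def)
  have contiguous_columns: "fdet (Suc n) (\<lambda>i j. A (p i) (q\<^sub>0 + int j)) > 0"
    if "\<And>i. i < Suc n \<Longrightarrow> q\<^sub>0 + int i \<in> I" for q\<^sub>0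
  proof (rule fekete_rows[where B = "\<lambda>x j. A x (q\<^sub>0 + int j)", OF I])
    show "fdet (Suc n - 1) (\<lambda>i j. A (p' i) (q\<^sub>0 + int j)) > 0"
      if "strict_mono_on {..<Suc n - 1} p'" "p' \<in> {..<Suc n - 1} \<rightarrow> I" for p'
      using Suc.IH[of p' "\<lambda>j. q\<^sub>0 + int j"] that \<open>\<And>i. i < Suc n \<Longrightarrow> q\<^sub>0 + int i \<in> I\<close>
      by (auto simp: strict_mono_on_def)
  qed (use contiguous that Suc.prems in auto)
  have "fdet (Suc n) (\<lambda>j i. A (p i) (q j)) > 0"
  proof (rule fekete_rows[where B = "\<lambda>y i. A (p i) y", OF I])
    show "fdet (Suc n) (\<lambda>j i. A (p i) (q\<^sub>0 + int j)) > 0"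
      if "\<And>i. i < Suc n \<Longrightarrow> q\<^sub>0 + int i \<in> I" for q\<^sub>0
      using contiguous_columns[OF that] by (subst fdet_transpose)
    show "fdet (Suc n - 1) (\<lambda>j i. A (p i) (q' j)) > 0"
      if "strict_mono_on {..<Suc n - 1} q'" "q' \<in> {..<Suc n - 1} \<rightarrow> I" for q'
      using Suc.IH[of p q'] that Suc.prems mono_less by (subst fdet_transpose) (auto simp: Pi_iff)
  qed (use Suc.prems in auto)
  then show ?case
    by (subst fdet_transpose)
qed

text \<open>
  A vanishing minor of a totally non-negative kernel casts a shadow: the points of one side can be
  moved one after the other within their gaps, and the minor stays zero.
\<close>

lemma zero_minor_move:
  fixes B :: "real \<Rightarrow> nat \<Rightarrow> real"
  assumes low: "\<And>p. strict_mono_on {..<n - 1} p \<Longrightarrow> p \<in> {..<n - 1} \<rightarrow> X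
      \<Longrightarrow> fdet (n - 1) (\<lambda>i j. B (p i) j) > 0"
    and nonneg: "\<And>p. strict_mono_on {..<n} p \<Longrightarrow> p \<in> {..<n} \<rightarrow> X
      \<Longrightarrow> fdet n (\<lambda>i j. B (p i) j) \<ge> 0"
    and p: "strict_mono_on {..<n} p" "p \<in> {..<n} \<rightarrow> X" "fdet n (\<lambda>i j. B (p i) j) = 0"
    and k: "0 < k" "k < n" "p (k - 1) < r" "r < p k" "r \<in> X" and l: "l = k - 1 \<or> l = k"
  shows "strict_mono_on {..<n} (p(l := r))" "p(l := r) \<in> {..<n} \<rightarrow> X"
    "fdet n (\<lambda>i j. B ((p(l := r)) i) j) = 0"
proof -
  define q where "q = insert_at k r p"
  have q: "strict_mono_on {..<Suc n} q" "q \<in> {..<Suc n} \<rightarrow> X"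
    unfolding q_def using strict_mono_on_insert_at[OF p(1) k(1-4)] insert_at_Pi[OF p(2) k(5,2)] by auto
  define D where "D = (\<lambda>i. fdet n (\<lambda>i' j. B (q (insert_index i i')) j))"
  have "\<exists>\<alpha> \<beta> \<gamma>. \<alpha> > 0 \<and> \<beta> > 0 \<and> \<gamma> > 0 \<and> D k * \<beta> = D (k - 1) * \<alpha> + D (Suc k) * \<gamma>"
    unfolding D_def by (rule three_minors_relation[OF q low]) (use k in auto)
  then obtain \<alpha> \<beta> \<gamma> where rel: "\<alpha> > 0" "\<gamma> > 0" "D k * \<beta> = D (k - 1) * \<alpha> + D (Suc k) * \<gamma>"
    by blast
  have "D k = 0"
    using p(3) by (simp add: D_def q_def)
  have D_nonneg: "D i \<ge> 0" for i
    unfolding D_def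
    by (rule nonneg) (use strict_mono_on_insert_index[OF q(1)] q(2) insert_index_less_Suc in \<open>auto simp: Pi_iff\<close>)
  have "D (k - 1) * \<alpha> + D (Suc k) * \<gamma> = 0"
    using rel(3) \<open>D k = 0\<close> by simp
  then have D0: "D (k - 1) = 0" "D (Suc k) = 0"
    using D_nonneg rel(1,2) by (simp_all add: add_nonneg_eq_0_iff)
  \<comment> \<open>The new point is entry \<open>k\<close> of \<open>q\<close>; its neighbours, at
    \<open>k - 1\<close> and \<open>Suc k\<close>, are the old \<open>p (k - 1)\<close> and
    \<open>p k\<close>. Deleting a neighbour amounts to replacing it by \<open>r\<close>.\<close>
  define i where "i = (if l = k then Suc k else k - 1)"
  have eq: "(p(l := r)) i' = q (insert_index i i')" for i'
    using l k(1) by (auto simp: i_def q_def insert_at_def insert_index_def)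
  then show "strict_mono_on {..<n} (p(l := r))"
    using strict_mono_on_insert_index[OF q(1), of i] by presburger
  show "p(l := r) \<in> {..<n} \<rightarrow> X"
    using p(2) k(5) by auto
  show "fdet n (\<lambda>i j. B ((p(l := r)) i) j) = 0"
    unfolding eq using D0 l by (auto simp: D_def i_def)
qed

lemma zero_minor_rational:
  fixes B :: "real \<Rightarrow> nat \<Rightarrow> real"
  assumes X: "is_interval X" and n: "n \<ge> 2"
    and low: "\<And>p. strict_mono_on {..<n - 1} p \<Longrightarrow> p \<in> {..<n - 1} \<rightarrow> X
      \<Longrightarrow> fdet (n - 1) (\<lambda>i j. B (p i) j) > 0"
    and nonneg: "\<And>p. strict_mono_on {..<n} p \<Longrightarrow> p \<in> {..<n} \<rightarrow> X
      \<Longrightarrow> fdet n (\<lambda>i j. B (p i) j) \<ge> 0"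
    and p: "strict_mono_on {..<n} p" "p \<in> {..<n} \<rightarrow> X" "fdet n (\<lambda>i j. B (p i) j) = 0"
  obtains q where "strict_mono_on {..<n} q" "q \<in> {..<n} \<rightarrow> X" "fdet n (\<lambda>i j. B (q i) j) = 0"
    "\<And>i. i < n \<Longrightarrow> q i \<in> \<rat>"
proof -
  have "\<exists>q. strict_mono_on {..<n} q \<and> q \<in> {..<n} \<rightarrow> X \<and> fdet n (\<lambda>i j. B (q i) j) = 0
      \<and> (\<forall>i<m. q i \<in> \<rat>)" if "m \<le> n" for m
    using that
  proof (induction m)
    case 0
    then show ?case
      using p by blast
  next
    case (Suc m)
    then obtain q where q: "strict_mono_on {..<n} q" "q \<in> {..<n} \<rightarrow> X"
        "fdet n (\<lambda>i j. B (q i) j) = 0" "\<forall>i<m. q i \<in> \<rat>"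
      by auto
    \<comment> \<open>Point \<open>m\<close> moves into the gap on its left. Point 0 has none and
      moves towards point 1, which exists because \<open>n \<ge> 2\<close>.\<close>
    define k where "k = (if m = 0 then 1 else m)"
    have k: "0 < k" "k < n" "m = k - 1 \<or> m = k"
      using Suc.prems n by (auto simp: k_def)
    have "q (k - 1) < q k"
      using strict_mono_onD[OF q(1), of "k - 1" k] k by auto
    then obtain r where r: "r \<in> \<rat>" "q (k - 1) < r" "r < q k"
      using Rats_dense_in_real by blast
    have "r \<in> X"
      using X q(2) k r mem_is_interval_1_I[OF X, of "q (k - 1)" "q k" r] by (auto simp: Pi_iff)
    note move = zero_minor_move[OF low nonneg q(1-3) k(1,2) r(2,3) this k(3)]
    have "\<forall>i<Suc m. (q(m := r)) i \<in> \<rat>"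
      using q(4) r(1) by (auto simp: less_Suc_eq)
    then show ?case
      using move by blast
  qed
  from this[of n] that show thesis
    by blast
qed

section \<open>Quadratic forms\<close>

lemma fdet_identity: "fdet n (\<lambda>i j. if i = j then 1 else 0) = 1"
proof -
  have "Matrix.mat n n (\<lambda>(i, j). if i = j then 1 else 0) = (1\<^sub>m n :: real Matrix.mat)"
    by (auto intro!: eq_matI)
  then show ?thesis
    by (simp add: fdet_def)
qed

text \<open>The determinant does not vanish on the segment from the identity matrix to \<open>A\<close>.\<close>

lemma fdet_pos_if_positive_definite:
  assumes pd: "\<And>c. \<exists>i<n. c i \<noteq> 0 \<Longrightarrow> (\<Sum>i<n. \<Sum>j<n. c i * c j * A i j) > 0"
  shows "fdet n A > 0"
proof -
  define M where "M = (\<lambda>t i j. (1 - t) * (if i = j then 1 else 0) + t * A i j)"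
  define \<phi> where "\<phi> = (\<lambda>t. fdet n (M t))"
  have cont: "continuous_on {0..1} \<phi>"
    unfolding \<phi>_def fdet_permutations M_def by (intro continuous_intros)
  have nonzero: "\<phi> t \<noteq> 0" if t: "0 \<le> t" "t \<le> 1" for t
  proof
    assume "\<phi> t = 0"
    then obtain c where c: "\<exists>j<n. c j \<noteq> 0" "\<forall>i<n. (\<Sum>j<n. M t i j * c j) = 0"
      unfolding \<phi>_def fdet_eq_0_iff by blast
    have "0 = (\<Sum>i<n. c i * (\<Sum>j<n. M t i j * c j))"
      using c(2) by simp
    also have "\<dots> = (\<Sum>i<n. (1 - t) * (c i)\<^sup>2 + t * (\<Sum>j<n. c i * c j * A i j))"
    proof (rule sum.cong)
      fix i assume i: "i \<in> {..<n}"
      have "c i * (\<Sum>j<n. M t i j * c j)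
          = (\<Sum>j<n. (if j = i then (1 - t) * (c i)\<^sup>2 else 0) + t * (c i * c j * A i j))"
        unfolding sum_distrib_left M_def by (intro sum.cong) (auto simp: algebra_simps power2_eq_square)
      also have "\<dots> = (1 - t) * (c i)\<^sup>2 + t * (\<Sum>j<n. c i * c j * A i j)"
        using i by (simp add: sum.distrib sum_distrib_left)
      finally show "c i * (\<Sum>j<n. M t i j * c j) = (1 - t) * (c i)\<^sup>2 + t * (\<Sum>j<n. c i * c j * A i j)" .
    qed simp
    also have "\<dots> = (1 - t) * (\<Sum>i<n. (c i)\<^sup>2) + t * (\<Sum>i<n. \<Sum>j<n. c i * c j * A i j)"
      by (simp add: sum.distrib sum_distrib_left)
    finally have eq: "(1 - t) * (\<Sum>i<n. (c i)\<^sup>2) + t * (\<Sum>i<n. \<Sum>j<n. c i * c j * A i j) = 0"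
      by simp
    have squares: "(\<Sum>i<n. (c i)\<^sup>2) > 0"
    proof -
      obtain k where "k < n" "c k \<noteq> 0"
        using c(1) by blast
      then show ?thesis
        by (intro sum_pos2[of _ k]) auto
    qed
    have "(1 - t) * (\<Sum>i<n. (c i)\<^sup>2) + t * (\<Sum>i<n. \<Sum>j<n. c i * c j * A i j) > 0"
    proof (cases "t = 0")
      case False
      then show ?thesis
        using t squares pd[OF c(1)] by (intro add_nonneg_pos mult_nonneg_nonneg mult_pos_pos) auto
    qed (use squares in simp)
    then show False
      using eq by simp
  qed
  have "\<phi> 0 = 1"
    by (simp add: \<phi>_def M_def fdet_identity)
  moreover have "\<phi> 1 = fdet n A"
    by (simp add: \<phi>_def M_def)
  ultimately show ?thesis
  proof (intro ccontr[of "fdet n A > 0"])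
    assume "\<phi> 0 = 1" "\<phi> 1 = fdet n A" "\<not> fdet n A > 0"
    then obtain t where "0 \<le> t" "t \<le> 1" "\<phi> t = 0"
      using IVT2'[of \<phi> 1 0 0] cont by auto
    then show False
      using nonzero by blast
  qed
qed

section \<open>Gram factorisation of matrices with non-negative principal minors\<close>

lemma fdet_schur_complement:
  assumes "C 0 0 \<noteq> 0"
  shows "fdet (Suc m) C = C 0 0 * fdet m (\<lambda>i j. C (Suc i) (Suc j) - C (Suc i) 0 * C 0 (Suc j) / C 0 0)"
proof -
  \<comment> \<open>One elimination step: \<open>L\<close> is unit lower triangular and the first
    column of \<open>U\<close> vanishes below the top, so the determinant of \<open>U\<close> splits
    off \<open>C 0 0\<close>.\<close>
  define L where "L = (\<lambda>i k. if i = k then 1 else if k = (0::nat) then C i 0 / C 0 0 else 0)"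
  define U where "U = (\<lambda>i j. if i = 0 then C 0 j else C i j - C i 0 * C 0 j / C 0 0)"
  let ?L = "Matrix.mat (Suc m) (Suc m) (\<lambda>(i, j). L i j)"
  let ?U = "Matrix.mat (Suc m) (Suc m) (\<lambda>(i, j). U i j)"
  have entry: "(\<Sum>k<Suc m. L i k * U k j) = C i j" if "i < Suc m" for i j
  proof (cases "i = 0")
    case True
    have "(\<Sum>k<Suc m. L i k * U k j) = (\<Sum>k\<in>{0}. L i k * U k j)"
      by (rule sum.mono_neutral_right) (auto simp: L_def True)
    then show ?thesis
      by (simp add: L_def U_def True)
  next
    case False
    have "(\<Sum>k<Suc m. L i k * U k j) = (\<Sum>k\<in>{0, i}. L i k * U k j)"
      by (rule sum.mono_neutral_right) (use that in \<open>auto simp: L_def\<close>)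
    then show ?thesis
      using False assms by (simp add: L_def U_def)
  qed
  have "Matrix.mat (Suc m) (Suc m) (\<lambda>(i, j). C i j) = ?L * ?U"
    by (rule eq_matI) (auto simp: scalar_prod_def entry simp flip: lessThan_atLeast0 simp del: sum.lessThan_Suc)
  then have "fdet (Suc m) C = Determinant.det ?L * fdet (Suc m) U"
    unfolding fdet_def by (subst det_mult[symmetric, of _ "Suc m"]) auto
  also have "Determinant.det ?L = prod_list (diag_mat ?L)"
    by (rule det_lower_triangular[of "Suc m"]) (auto simp: L_def)
  also have "\<dots> = 1"
  proof -
    have "prod_list (map (\<lambda>i. index_mat ?L (i, i)) [0..<k]) = 1" if "k \<le> Suc m" for k
      using that by (induction k) (auto simp: L_def)
    then show ?thesis
      by (simp add: diag_mat_def L_def)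
  qed
  also have "fdet (Suc m) U = (\<Sum>i<Suc m. (-1)^(i + 0) * U i 0 *
      fdet m (\<lambda>i' j'. U (insert_index i i') (insert_index 0 j')))"
    by (rule fdet_laplace_column) simp
  also have "\<dots> = (\<Sum>i\<in>{0}. (-1)^(i + 0) * U i 0 *
      fdet m (\<lambda>i' j'. U (insert_index i i') (insert_index 0 j')))"
    by (rule sum.mono_neutral_right) (use assms in \<open>auto simp: U_def\<close>)
  finally show ?thesis
    by (simp add: U_def)
qed

lemma fdet_2: "fdet 2 A = A 0 0 * A (Suc 0) (Suc 0) - A 0 (Suc 0) * A (Suc 0) 0"
  by (simp add: fdet_laplace_row[of 0] fdet_1 numeral_2_eq_2)

text \<open>A Cholesky factorisation that splits off index 0. Leading minors would not do: at a zero
  pivot, 2 by 2 principal minors must force the whole first row to vanish. The factorisation feeds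
  both the passage from minors to forms and the Schur product.\<close>

lemma gram_if_principal_minors_nonneg:
  fixes A :: "nat \<Rightarrow> nat \<Rightarrow> real"
  assumes "\<And>i j. i < n \<Longrightarrow> j < n \<Longrightarrow> A i j = A j i"
    and "\<And>m p. strict_mono_on {..<m} p \<Longrightarrow> p \<in> {..<m} \<rightarrow> {..<n} \<Longrightarrow> fdet m (\<lambda>i j. A (p i) (p j)) \<ge> 0"
  obtains w :: "nat \<Rightarrow> nat \<Rightarrow> real"
  where "\<And>i j. i < n \<Longrightarrow> j < n \<Longrightarrow> A i j = (\<Sum>l<n. w l i * w l j)"
proof -
  have "\<exists>w :: nat \<Rightarrow> nat \<Rightarrow> real. \<forall>i<n. \<forall>j<n. A i j = (\<Sum>l<n. w l i * w l j)"
    using assms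
  proof (induction n arbitrary: A)
    case 0
    then show ?case by simp
  next
    case (Suc n)
    note sym = Suc.prems(1) and minors = Suc.prems(2)
    have extend: ?case
      if B: "\<And>i j. i < n \<Longrightarrow> j < n \<Longrightarrow> A (Suc i) (Suc j) - v (Suc i) * v (Suc j) = (\<Sum>l<n. w l i * w l j)"
        and v: "\<And>j. j < Suc n \<Longrightarrow> A 0 j = v 0 * v j" for v and w :: "nat \<Rightarrow> nat \<Rightarrow> real"
    proof (intro exI allI impI)
      \<comment> \<open>The vector with index \<open>n\<close> is the new one; the old vectors are
        shifted by one place and vanish at 0.\<close>
      let ?w = "\<lambda>l i. if l = n then v i else if i = 0 then 0 else w l (i - 1)"
      fix i j assume ij: "i < Suc n" "j < Suc n"
      have "(\<Sum>l<Suc n. ?w l i * ?w l j) = (\<Sum>l<n. ?w l i * ?w l j) + v i * v j"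
        by simp
      also have "\<dots> = A i j"
      proof (cases "i = 0 \<or> j = 0")
        case True
        then have "(\<Sum>l<n. ?w l i * ?w l j) = 0"
          by (intro sum.neutral) auto
        then show ?thesis
          using True v ij sym by (metis add_0 mult.commute zero_less_Suc)
      next
        case False
        then obtain i' j' where "i = Suc i'" "j = Suc j'"
          by (metis not0_implies_Suc)
        then show ?thesis
          using B[of i' j'] ij by simp
      qed
      finally show "A i j = (\<Sum>l<Suc n. ?w l i * ?w l j)" ..
    qed
    have A00: "A 0 0 \<ge> 0"
    proof -
      have "strict_mono_on {..<Suc 0} (\<lambda>i::nat. i)"
        by (auto simp: strict_mono_on_def)
      from minors[OF this] show ?thesis
        by (simp add: fdet_1)
    qed
    show ?case
    proof (cases "A 0 0 = 0")
      case True
      have zero: "A 0 j = 0" if "j < Suc n" for j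
      proof (cases "j = 0")
        case False
        have "0 \<le> fdet 2 (\<lambda>i k. A (if i = 0 then 0 else j) (if k = 0 then 0 else j))"
          by (rule minors) (use that False in \<open>auto simp: strict_mono_on_def\<close>)
        then have "(A 0 j)\<^sup>2 \<le> 0"
          using True sym[of j 0] that by (simp add: fdet_2 power2_eq_square)
        then show ?thesis
          by simp
      qed (use True in simp)
      have "\<exists>w. \<forall>i<n. \<forall>j<n. A (Suc i) (Suc j) = (\<Sum>l<n. w l i * w l j)"
      proof (rule Suc.IH)
        show "0 \<le> fdet m (\<lambda>i j. A (Suc (p i)) (Suc (p j)))"
          if "strict_mono_on {..<m} p" "p \<in> {..<m} \<rightarrow> {..<n}" for m p
          using minors[of m "\<lambda>i. Suc (p i)"] that by (auto simp: strict_mono_on_def Pi_iff)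
      qed (use sym in auto)
      then obtain w where "\<forall>i<n. \<forall>j<n. A (Suc i) (Suc j) = (\<Sum>l<n. w l i * w l j)"
        by blast
      then show ?thesis
        by (intro extend[of "\<lambda>_. 0" w]) (use zero in auto)
    next
      case False
      then have pos: "A 0 0 > 0"
        using A00 by simp
      define B where "B = (\<lambda>i j. A (Suc i) (Suc j) - A (Suc i) 0 * A 0 (Suc j) / A 0 0)"
      have "\<exists>w. \<forall>i<n. \<forall>j<n. B i j = (\<Sum>l<n. w l i * w l j)"
      proof (rule Suc.IH)
        show "B i j = B j i" if "i < n" "j < n" for i j
          using sym[of "Suc i" "Suc j"] sym[of 0 "Suc i"] sym[of 0 "Suc j"] that by (simp add: B_def)
        fix m and p :: "nat \<Rightarrow> nat"
        assume p: "strict_mono_on {..<m} p" "p \<in> {..<m} \<rightarrow> {..<n}"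
        \<comment> \<open>Adjoining index 0 turns a principal minor of the Schur complement into one
          of \<open>A\<close>, up to the positive factor \<open>A 0 0\<close>.\<close>
        define q where "q = (\<lambda>i. case i of 0 \<Rightarrow> 0 | Suc i \<Rightarrow> Suc (p i))"
        have "strict_mono_on {..<Suc m} q"
          using p(1) by (auto simp: q_def strict_mono_on_def split: nat.splits)
        moreover have "q \<in> {..<Suc m} \<rightarrow> {..<Suc n}"
          using p(2) by (auto simp: q_def Pi_iff split: nat.splits)
        ultimately have "0 \<le> fdet (Suc m) (\<lambda>i j. A (q i) (q j))"
          by (rule minors)
        also have "\<dots> = A 0 0 * fdet m (\<lambda>i j. B (p i) (p j))"
          by (subst fdet_schur_complement) (use False in \<open>simp_all add: q_def B_def\<close>)
        finally show "0 \<le> fdet m (\<lambda>i j. B (p i) (p j))"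
          using pos by (simp add: zero_le_mult_iff)
      qed
      then obtain w where w: "\<forall>i<n. \<forall>j<n. B i j = (\<Sum>l<n. w l i * w l j)"
        by blast
      have sqrt: "sqrt (A 0 0) * sqrt (A 0 0) = A 0 0"
        using pos by simp
      show ?thesis
      proof (rule extend[of "\<lambda>i. A 0 i / sqrt (A 0 0)" w])
        fix i j assume "i < n" "j < n"
        then show "A (Suc i) (Suc j) - A 0 (Suc i) / sqrt (A 0 0) * (A 0 (Suc j) / sqrt (A 0 0))
            = (\<Sum>l<n. w l i * w l j)"
          using w sym[of 0 "Suc i"] pos by (simp add: B_def sqrt)
      qed (use pos in \<open>simp add: sqrt\<close>)
    qed
  qed
  with that show thesis
    by blast
qed

lemma quadratic_form_gram:
  fixes A :: "nat \<Rightarrow> nat \<Rightarrow> real"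
  assumes "\<And>i j. i < n \<Longrightarrow> j < n \<Longrightarrow> A i j = (\<Sum>l<m. w l i * w l j)"
  shows "(\<Sum>i<n. \<Sum>j<n. c i * c j * A i j) = (\<Sum>l<m. (\<Sum>i<n. c i * w l i)\<^sup>2)"
proof -
  have "(\<Sum>i<n. \<Sum>j<n. c i * c j * A i j) = (\<Sum>i<n. \<Sum>j<n. \<Sum>l<m. (c i * w l i) * (c j * w l j))"
    by (intro sum.cong refl) (simp add: assms sum_distrib_left mult_ac)
  also have "\<dots> = (\<Sum>i<n. \<Sum>l<m. \<Sum>j<n. (c i * w l i) * (c j * w l j))"
    by (intro sum.cong refl sum.swap)
  also have "\<dots> = (\<Sum>l<m. \<Sum>i<n. \<Sum>j<n. (c i * w l i) * (c j * w l j))"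
    by (rule sum.swap)
  also have "\<dots> = (\<Sum>l<m. (\<Sum>i<n. c i * w l i)\<^sup>2)"
    by (simp add: power2_eq_square sum_product)
  finally show ?thesis .
qed

lemma quadratic_form_schur_product:
  fixes A B :: "nat \<Rightarrow> nat \<Rightarrow> real"
  assumes "\<And>i j. i < n \<Longrightarrow> j < n \<Longrightarrow> B i j = (\<Sum>l<m. w l i * w l j)"
  shows "(\<Sum>i<n. \<Sum>j<n. c i * c j * (A i j * B i j))
    = (\<Sum>l<m. \<Sum>i<n. \<Sum>j<n. (c i * w l i) * (c j * w l j) * A i j)"
proof -
  have "(\<Sum>i<n. \<Sum>j<n. c i * c j * (A i j * B i j))
      = (\<Sum>i<n. \<Sum>j<n. \<Sum>l<m. (c i * w l i) * (c j * w l j) * A i j)"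
    by (intro sum.cong refl) (simp add: assms sum_distrib_left mult_ac)
  also have "\<dots> = (\<Sum>i<n. \<Sum>l<m. \<Sum>j<n. (c i * w l i) * (c j * w l j) * A i j)"
    by (intro sum.cong refl sum.swap)
  also have "\<dots> = (\<Sum>l<m. \<Sum>i<n. \<Sum>j<n. (c i * w l i) * (c j * w l j) * A i j)"
    by (rule sum.swap)
  finally show ?thesis .
qed

section \<open>Hankel kernels on an interval\<close>

text \<open>
  On an interval \<open>X\<close> a Hankel kernel is determined by its diagonal: it is \<open>K(x, y) = g((x + y) / 2)\<close>
  with \<open>g(x) = K(x, x)\<close> on \<open>X\<close>.
\<close>

definition hankel_psd :: "real set \<Rightarrow> (real \<Rightarrow> real) \<Rightarrow> bool" where
  "hankel_psd X g \<longleftrightarrow> (\<forall>(n::nat) x c. strict_mono_on {..<n} x \<longrightarrow> x \<in> {..<n} \<rightarrow> X \<longrightarrow>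
    0 \<le> (\<Sum>i<n. \<Sum>j<n. c i * c j * g ((x i + x j) / 2)))"

text \<open>Distinct points are essential here: at repeated points a nonzero \<open>c\<close> can
  make the form vanish.\<close>

definition hankel_pd :: "real set \<Rightarrow> (real \<Rightarrow> real) \<Rightarrow> bool" where
  "hankel_pd X g \<longleftrightarrow> (\<forall>(n::nat) x c. strict_mono_on {..<n} x \<longrightarrow> x \<in> {..<n} \<rightarrow> X \<longrightarrow>
    (\<exists>i<n. c i \<noteq> 0) \<longrightarrow> 0 < (\<Sum>i<n. \<Sum>j<n. c i * c j * g ((x i + x j) / 2)))"

lemma hankel_psdD:
  fixes n :: nat
  shows "hankel_psd X g \<Longrightarrow> strict_mono_on {..<n} x \<Longrightarrow> x \<in> {..<n} \<rightarrow> X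
    \<Longrightarrow> 0 \<le> (\<Sum>i<n. \<Sum>j<n. c i * c j * g ((x i + x j) / 2))"
  unfolding hankel_psd_def by blast

lemma hankel_pdD:
  fixes n :: nat
  shows "hankel_pd X g \<Longrightarrow> strict_mono_on {..<n} x \<Longrightarrow> x \<in> {..<n} \<rightarrow> X \<Longrightarrow> \<exists>i<n. c i \<noteq> 0
    \<Longrightarrow> 0 < (\<Sum>i<n. \<Sum>j<n. c i * c j * g ((x i + x j) / 2))"
  unfolding hankel_pd_def by blast

lemma midpoint_in_interval:
  assumes "is_interval X" "a \<in> X" "b \<in> X"
  shows "(a + b) / 2 \<in> (X :: real set)"
proof (cases "a \<le> b")
  case True
  then show ?thesis
    using mem_is_interval_1_I[OF assms(1), of a b "(a + b) / 2"] assms by auto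
next
  case False
  then show ?thesis
    using mem_is_interval_1_I[OF assms(1), of b a "(a + b) / 2"] assms by auto
qed

lemma common_denominator:
  assumes "finite S" "S \<subseteq> \<rat>"
  shows "\<exists>N::nat. N > 0 \<and> (\<forall>s\<in>S. \<exists>p::int. s = of_int p / (of_nat N :: real))"
  using assms
proof (induction rule: finite_induct)
  case empty
  then show ?case by (intro exI[of _ 1]) auto
next
  case (insert s S)
  then obtain N where N: "N > 0" "\<forall>s\<in>S. \<exists>p::int. s = of_int p / (of_nat N :: real)"
    by auto
  obtain a b where ab: "b > 0" "s = of_int a / of_int b"
    using insert.prems by (metis Rats_cases' insert_subset)
  define M where "M = N * nat b"
  have M: "real M = real N * of_int b" "M > 0"
    using ab N by (auto simp: M_def)
  have "\<exists>p::int. s = of_int p / real M"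
    using ab N M by (intro exI[of _ "a * int N"]) (simp add: field_simps)
  moreover have "\<exists>p::int. t = of_int p / real M" if t: "t \<in> S" for t
  proof -
    obtain p :: int where "t = of_int p / real N"
      using N t by blast
    then show ?thesis
      using ab N M by (intro exI[of _ "p * b"]) (simp add: field_simps)
  qed
  ultimately show ?case
    using M(2) by blast
qed

lemma hankel_pd_rational_minor_pos:
  assumes X: "is_interval X" and g: "hankel_pd X g"
    and x: "strict_mono_on {..<n} x" "x \<in> {..<n} \<rightarrow> X" "\<And>i. i < n \<Longrightarrow> x i \<in> \<rat>"
    and y: "strict_mono_on {..<n} y" "y \<in> {..<n} \<rightarrow> X" "\<And>i. i < n \<Longrightarrow> y i \<in> \<rat>"
  shows "fdet n (\<lambda>i j. g ((x i + y j) / 2)) > 0"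
proof -
  obtain N where N: "N > 0" "\<forall>s\<in>x ` {..<n} \<union> y ` {..<n}. \<exists>p::int. s = of_int p / (of_nat N :: real)"
    using common_denominator[of "x ` {..<n} \<union> y ` {..<n}"] x(3) y(3) by auto
  then have "\<forall>i. \<exists>p::int. i < n \<longrightarrow> x i = of_int p / real N" "\<forall>i. \<exists>p::int. i < n \<longrightarrow> y i = of_int p / real N"
    by auto
  then obtain p q :: "nat \<Rightarrow> int" where p: "\<And>i. i < n \<Longrightarrow> x i = of_int (p i) / real N"
    and q: "\<And>i. i < n \<Longrightarrow> y i = of_int (q i) / real N"
    by metis
  define I where "I = {k::int. of_int k / real N \<in> X}"
  define A where "A = (\<lambda>k l::int. g ((of_int k / real N + of_int l / real N) / 2))"
  have "fdet n (\<lambda>i j. A (p i) (q j)) > 0"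
  proof (rule fekete[where I = I])
    show "b \<in> I" if "a \<in> I" "c \<in> I" "a \<le> b" "b \<le> c" for a b c
      using that mem_is_interval_1_I[OF X, of "of_int a / real N" "of_int c / real N" "of_int b / real N"] N(1)
      by (auto simp: I_def divide_right_mono)
    show "strict_mono_on {..<n} p"
    proof (rule strict_mono_onI)
      fix i j assume "i \<in> {..<n}" "j \<in> {..<n}" "i < j"
      then have "of_int (p i) / real N < of_int (p j) / real N"
        using strict_mono_onD[OF x(1), of i j] p by auto
      then show "p i < p j"
        using N(1) by (simp add: divide_less_cancel)
    qed
    show "strict_mono_on {..<n} q"
    proof (rule strict_mono_onI)
      fix i j assume "i \<in> {..<n}" "j \<in> {..<n}" "i < j"
      then have "of_int (q i) / real N < of_int (q j) / real N"
        using strict_mono_onD[OF y(1), of i j] q by auto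
      then show "q i < q j"
        using N(1) by (simp add: divide_less_cancel)
    qed
    show "p \<in> {..<n} \<rightarrow> I" "q \<in> {..<n} \<rightarrow> I"
      using x(2) y(2) p q by (auto simp: I_def Pi_iff)
    fix m and p\<^sub>0 q\<^sub>0 :: int
    assume p0: "\<And>i. i < m \<Longrightarrow> p\<^sub>0 + int i \<in> I" and q0: "\<And>i. i < m \<Longrightarrow> q\<^sub>0 + int i \<in> I"
    \<comment> \<open>Midpoints of the \<open>i\<close>-th row point and the \<open>i\<close>-th
      column point. They form a progression with step \<open>1 / N\<close>, and their pairwise
      midpoints are precisely the arguments in the contiguous minor.\<close>
    define z where "z = (\<lambda>i::nat. (of_int (p\<^sub>0 + int i) / real N + of_int (q\<^sub>0 + int i) / real N) / 2)"
    have "z \<in> {..<m} \<rightarrow> X"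
      using p0 q0 midpoint_in_interval[OF X] by (auto simp: z_def I_def)
    moreover have "strict_mono_on {..<m} z"
    proof (rule strict_mono_onI)
      have "z i = of_int (p\<^sub>0 + q\<^sub>0) / real N / 2 + real i / real N" for i
        by (simp add: z_def add_divide_distrib)
      then show "z i < z j" if "i < j" for i j
        using that N(1) by (simp add: divide_strict_right_mono)
    qed
    ultimately have "fdet m (\<lambda>i j. g ((z i + z j) / 2)) > 0"
      using g by (intro fdet_pos_if_positive_definite hankel_pdD) auto
    moreover have "(z i + z j) / 2 = (of_int (p\<^sub>0 + int i) / real N + of_int (q\<^sub>0 + int j) / real N) / 2" for i j
      by (simp add: z_def add_divide_distrib)
    ultimately show "fdet m (\<lambda>i j. A (p\<^sub>0 + int i) (q\<^sub>0 + int j)) > 0"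
      by (simp add: A_def)
  qed
  also have "fdet n (\<lambda>i j. A (p i) (q j)) = fdet n (\<lambda>i j. g ((x i + y j) / 2))"
    by (intro fdet_cong) (simp add: A_def p q)
  finally show ?thesis .
qed

section \<open>Passage from rational to real points\<close>

lemma rational_approximation:
  fixes x :: "nat \<Rightarrow> real"
  assumes X: "open X" "is_interval X" and x: "strict_mono_on {..<n} x" "x \<in> {..<n} \<rightarrow> X"
  obtains r :: "nat \<Rightarrow> nat \<Rightarrow> real"
  where "\<And>m. strict_mono_on {..<n} (r m)" "\<And>m. r m \<in> {..<n} \<rightarrow> X"
    "\<And>m i. r m i \<in> \<rat>" "\<And>i. (\<lambda>m. r m i) \<longlonglongrightarrow> x i"
proof -
  have lim: "((\<lambda>d. x i + d) \<longlongrightarrow> x i) (at_right 0)" for i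
    by (auto intro!: tendsto_eq_intros)
  have "\<forall>\<^sub>F d in at_right 0. \<forall>i\<in>{..<n}. x i + d \<in> X"
    by (intro eventually_ball_finite ballI topological_tendstoD[OF lim X(1)]) (use x(2) in auto)
  moreover have "\<forall>\<^sub>F d in at_right 0. \<forall>i\<in>{..<n}. \<forall>j\<in>{..<n}. i < j \<longrightarrow> x i + d < x j"
  proof (intro eventually_ball_finite ballI)
    fix i j assume "i \<in> {..<n}" "j \<in> {..<n}"
    then show "\<forall>\<^sub>F d in at_right 0. i < j \<longrightarrow> x i + d < x j"
      using order_tendstoD(2)[OF lim, of i "x j"] strict_mono_onD[OF x(1), of i j] by (cases "i < j") auto
  qed auto
  ultimately have "\<forall>\<^sub>F d in at_right 0. d > 0 \<and> (\<forall>i<n. x i + d \<in> X) \<and>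
      (\<forall>i<n. \<forall>j<n. i < j \<longrightarrow> x i + d < x j)"
    using eventually_at_right_less[of 0] by eventually_elim auto
  from eventually_happens'[OF trivial_limit_at_right_real this]
  obtain d where d: "d > 0" "\<And>i. i < n \<Longrightarrow> x i + d \<in> X"
      "\<And>i j. i < n \<Longrightarrow> j < n \<Longrightarrow> i < j \<Longrightarrow> x i + d < x j"
    by blast
  \<comment> \<open>Each approximant exceeds \<open>x i\<close> by less than \<open>d\<close>, which
    is below all gaps, so neither the order nor membership in \<open>X\<close> is lost.\<close>
  have "\<exists>q. q \<in> \<rat> \<and> x i < q \<and> q < x i + d / real (Suc m)" for m i
    using d(1) Rats_dense_in_real[of "x i" "x i + d / real (Suc m)"] by auto
  then have "\<forall>m. \<exists>q. \<forall>i. q i \<in> \<rat> \<and> x i < q i \<and> q i < x i + d / real (Suc m)"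
    by (intro allI choice)
  then have "\<exists>r. \<forall>m i. r m i \<in> \<rat> \<and> x i < r m i \<and> r m i < x i + d / real (Suc m)"
    by (rule choice)
  then obtain r where r: "\<And>m i. r m i \<in> \<rat>" "\<And>m i. x i < r m i" "\<And>m i. r m i < x i + d / real (Suc m)"
    by blast
  have le: "r m i < x i + d" for m i
  proof -
    have "d / real (Suc m) \<le> d"
      using d(1) by (simp add: divide_le_eq)
    then show ?thesis
      using r(3)[of m i] by linarith
  qed
  show thesis
  proof (rule that[of r])
    show "strict_mono_on {..<n} (r m)" for m
    proof (rule strict_mono_onI)
      fix i j assume "i \<in> {..<n}" "j \<in> {..<n}" "i < j"
      then show "r m i < r m j"
        using le[of m i] d(3)[of i j] r(2)[of j m] by auto
    qed
    show "r m \<in> {..<n} \<rightarrow> X" for m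
    proof
      fix i assume "i \<in> {..<n}"
      then show "r m i \<in> X"
        using mem_is_interval_1_I[OF X(2), of "x i" "x i + d" "r m i"] x(2) d(2)[of i] r(2)[of i m] le[of m i] by auto
    qed
    show "(\<lambda>m. r m i) \<longlonglongrightarrow> x i" for i
    proof (rule tendsto_sandwich[of "\<lambda>_. x i" _ _ "\<lambda>m. x i + d / real (Suc m)"])
      have "(\<lambda>m. x i + d * inverse (real (Suc m))) \<longlonglongrightarrow> x i + d * 0"
        by (intro tendsto_intros LIMSEQ_inverse_real_of_nat)
      then show "(\<lambda>m. x i + d / real (Suc m)) \<longlonglongrightarrow> x i"
        by (simp add: divide_inverse)
    qed (use r(2,3) in \<open>auto intro!: always_eventually less_imp_le simp del: of_nat_Suc\<close>)
  qed (rule r(1))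
qed

lemma hankel_pd_minor_nonneg:
  assumes X: "open X" "is_interval X" and g: "hankel_pd X g" "continuous_on X g"
    and x: "strict_mono_on {..<n} x" "x \<in> {..<n} \<rightarrow> X"
    and y: "strict_mono_on {..<n} y" "y \<in> {..<n} \<rightarrow> X"
  shows "fdet n (\<lambda>i j. g ((x i + y j) / 2)) \<ge> 0"
proof -
  obtain r where r: "\<And>m. strict_mono_on {..<n} (r m)" "\<And>m. r m \<in> {..<n} \<rightarrow> X"
    "\<And>m i. r m i \<in> \<rat>" "\<And>i. (\<lambda>m. r m i) \<longlonglongrightarrow> x i"
    using rational_approximation[OF X x] by metis
  obtain s where s: "\<And>m. strict_mono_on {..<n} (s m)" "\<And>m. s m \<in> {..<n} \<rightarrow> X"
    "\<And>m i. s m i \<in> \<rat>" "\<And>i. (\<lambda>m. s m i) \<longlonglongrightarrow> y i"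
    using rational_approximation[OF X y] by metis
  have "(\<lambda>m. fdet n (\<lambda>i j. g ((r m i + s m j) / 2))) \<longlonglongrightarrow> fdet n (\<lambda>i j. g ((x i + y j) / 2))"
  proof (rule fdet_tendsto)
    fix i j assume "i < n" "j < n"
    then have "(x i + y j) / 2 \<in> X"
      using midpoint_in_interval[OF X(2)] x(2) y(2) by auto
    then have "isCont g ((x i + y j) / 2)"
      using g(2) X(1) by (simp add: continuous_on_eq_continuous_at)
    moreover have "(\<lambda>m. (r m i + s m j) / 2) \<longlonglongrightarrow> (x i + y j) / 2"
      by (intro tendsto_intros r s) simp
    ultimately show "(\<lambda>m. g ((r m i + s m j) / 2)) \<longlonglongrightarrow> g ((x i + y j) / 2)"
      by (rule isCont_tendsto_compose)
  qed
  moreover have "fdet n (\<lambda>i j. g ((r m i + s m j) / 2)) > 0" for m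
    using hankel_pd_rational_minor_pos[OF X(2) g(1)] r s by blast
  ultimately show ?thesis
    by (intro LIMSEQ_le_const) (auto intro: less_imp_le)
qed

text \<open>Strong induction on \<open>n\<close>, because moving a zero requires the smaller minors
  to be positive at arbitrary real points. The rows are made rational first; the columns follow, by
  transposition, with the rational rows kept.\<close>

theorem hankel_pd_minor_pos:
  assumes X: "open X" "is_interval X" and g: "hankel_pd X g" "continuous_on X g"
    and x: "strict_mono_on {..<n} x" "x \<in> {..<n} \<rightarrow> X"
    and y: "strict_mono_on {..<n} y" "y \<in> {..<n} \<rightarrow> X"
  shows "fdet n (\<lambda>i j. g ((x i + y j) / 2)) > 0"
  using x y
proof (induction n arbitrary: x y rule: less_induct)
  case (less n)
  note x = less.prems(1,2) and y = less.prems(3,4)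
  consider "n = 0" | "n = 1" | "n \<ge> 2"
    by linarith
  then show ?case
  proof cases
    case 1
    then show ?thesis by simp
  next
    case 2
    define z where "z = (x 0 + y 0) / 2"
    have "z \<in> X"
      unfolding z_def using midpoint_in_interval[OF X(2)] x(2) y(2) 2 by auto
    moreover have "strict_mono_on {..<1} (\<lambda>i::nat. z + real i)"
      by (auto simp: strict_mono_on_def)
    ultimately show ?thesis
      using hankel_pdD[OF g(1), of 1 "\<lambda>i. z + real i" "\<lambda>_. 1"] 2 by (simp add: fdet_1 z_def)
  next
    case 3
    have low: "fdet (n - 1) (\<lambda>i j. g ((x i + y j) / 2)) > 0"
      if "strict_mono_on {..<n - 1} x" "x \<in> {..<n - 1} \<rightarrow> X" "strict_mono_on {..<n} y" "y \<in> {..<n} \<rightarrow> X" for x y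
    proof (rule less.IH)
      show "strict_mono_on {..<n - 1} y"
        by (rule strict_mono_onI, rule strict_mono_onD[OF that(3)]) auto
    qed (use that 3 in \<open>auto simp: Pi_iff\<close>)
    have nonneg: "fdet n (\<lambda>i j. g ((x i + y j) / 2)) \<ge> 0"
      if "strict_mono_on {..<n} x" "x \<in> {..<n} \<rightarrow> X" "strict_mono_on {..<n} y" "y \<in> {..<n} \<rightarrow> X" for x y
      using hankel_pd_minor_nonneg[OF X g that] .
    have "fdet n (\<lambda>i j. g ((x i + y j) / 2)) \<noteq> 0"
    proof
      assume zero: "fdet n (\<lambda>i j. g ((x i + y j) / 2)) = 0"
      obtain x' where x': "strict_mono_on {..<n} x'" "x' \<in> {..<n} \<rightarrow> X"
        "fdet n (\<lambda>i j. g ((x' i + y j) / 2)) = 0" "\<And>i. i < n \<Longrightarrow> x' i \<in> \<rat>"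
        using zero_minor_rational[where B = "\<lambda>u j. g ((u + y j) / 2)", OF X(2) 3 low[OF _ _ y] nonneg[OF _ _ y] x zero]
        by blast
      have swap: "fdet m (\<lambda>j i. g ((q j + x' i) / 2)) = fdet m (\<lambda>i j. g ((x' i + q j) / 2))" for m q
        by (subst fdet_transpose) (simp add: add.commute)
      obtain y' where y': "strict_mono_on {..<n} y'" "y' \<in> {..<n} \<rightarrow> X"
        "fdet n (\<lambda>j i. g ((y' j + x' i) / 2)) = 0" "\<And>i. i < n \<Longrightarrow> y' i \<in> \<rat>"
        using zero_minor_rational[where B = "\<lambda>u i. g ((u + x' i) / 2)", OF X(2) 3 low[OF _ _ x'(1,2)]
            nonneg[OF _ _ x'(1,2)] y] x'(3) unfolding swap by blast
      show False
        using hankel_pd_rational_minor_pos[OF X(2) g(1) y'(1,2,4) x'(1,2,4)] y'(3) by simp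
    qed
    then show ?thesis
      using nonneg[OF x y] by simp
  qed
qed

text \<open>Injectivity of the transposed Vandermonde matrix: the Lagrange product \<open>P\<close>
  vanishes at every node except \<open>u i\<close> and has degree below \<open>n\<close>, so pairing
  it with \<open>d\<close> isolates \<open>d i\<close>.\<close>

lemma power_sums_eq_0_imp_eq_0:
  fixes u d :: "nat \<Rightarrow> real"
  assumes u: "inj_on u {..<n}" and zero: "\<And>k. k < n \<Longrightarrow> (\<Sum>i<n. d i * u i ^ k) = 0" and "i < n"
  shows "d i = 0"
proof -
  define P where "P = (\<Prod>j\<in>{..<n} - {i}. [:- u j, 1:])"
  have "degree P \<le> (\<Sum>j\<in>{..<n} - {i}. 1)"
    unfolding P_def by (rule order.trans[OF degree_prod_sum_le]) auto
  then have deg: "degree P < n"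
    using \<open>i < n\<close> by simp
  have "(\<Sum>l<n. d l * poly P (u l)) = (\<Sum>l<n. \<Sum>k\<le>degree P. d l * (coeff P k * u l ^ k))"
    by (simp add: poly_altdef sum_distrib_left)
  also have "\<dots> = (\<Sum>k\<le>degree P. \<Sum>l<n. d l * (coeff P k * u l ^ k))"
    by (rule sum.swap)
  also have "\<dots> = (\<Sum>k\<le>degree P. coeff P k * (\<Sum>l<n. d l * u l ^ k))"
    by (simp add: sum_distrib_left mult_ac)
  also have "\<dots> = 0"
    using zero deg by (intro sum.neutral) auto
  finally have "(\<Sum>l<n. d l * poly P (u l)) = 0" .
  moreover have "(\<Sum>l<n. d l * poly P (u l)) = (\<Sum>l\<in>{i}. d l * poly P (u l))"
    by (rule sum.mono_neutral_right) (use \<open>i < n\<close> in \<open>auto simp: P_def poly_prod\<close>)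
  moreover have "poly P (u i) \<noteq> 0"
    using u \<open>i < n\<close> by (auto simp: P_def poly_prod inj_on_def)
  ultimately show ?thesis
    by simp
qed

text \<open>With \<open>u = x - p\<close> and \<open>v = y - p\<close> the exponent is half the
  square of \<open>u + v\<close>, so after rescaling \<open>c\<close> the kernel is
  \<open>exp (u * v)\<close>, whose series turns the form into a series of squares of power sums.
  The centre \<open>p\<close> is left free so that the diagonal can be made monotone near a chosen
  point.\<close>

lemma hankel_pd_gauss: "hankel_pd X (\<lambda>m. exp (2 * (m - p)\<^sup>2))"
  unfolding hankel_pd_def
proof (intro allI impI)
  fix n :: nat and x c :: "nat \<Rightarrow> real"
  assume x: "strict_mono_on {..<n} x" and c: "\<exists>i<n. c i \<noteq> 0"
  define u where "u = (\<lambda>i. x i - p)"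
  define d where "d = (\<lambda>i. c i * exp ((u i)\<^sup>2 / 2))"
  let ?Q = "\<Sum>i<n. \<Sum>j<n. c i * c j * exp (2 * ((x i + x j) / 2 - p)\<^sup>2)"
  have "2 * ((x i + x j) / 2 - p)\<^sup>2 = (u i)\<^sup>2 / 2 + (u j)\<^sup>2 / 2 + u i * u j" for i j
    by (simp add: u_def power2_eq_square field_simps)
  then have Q: "?Q = (\<Sum>i<n. \<Sum>j<n. d i * d j * exp (u i * u j))"
    by (simp add: d_def exp_add mult_ac)
  have "(\<lambda>k. \<Sum>i<n. \<Sum>j<n. d i * d j * ((u i * u j) ^ k /\<^sub>R fact k)) sums (\<Sum>i<n. \<Sum>j<n. d i * d j * exp (u i * u j))"
    by (intro sums_sum sums_mult exp_converges)
  moreover have "(\<Sum>i<n. \<Sum>j<n. d i * d j * ((u i * u j) ^ k /\<^sub>R fact k)) = (\<Sum>i<n. d i * u i ^ k)\<^sup>2 / fact k" for k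
    by (simp add: power2_eq_square sum_product sum_distrib_left power_mult_distrib divide_inverse mult_ac)
  ultimately have sums: "(\<lambda>k. (\<Sum>i<n. d i * u i ^ k)\<^sup>2 / fact k) sums ?Q"
    by (simp only: Q)
  have "\<exists>k. (\<Sum>i<n. d i * u i ^ k) \<noteq> 0"
  proof (rule ccontr)
    assume zero: "\<not> (\<exists>k. (\<Sum>i<n. d i * u i ^ k) \<noteq> 0)"
    have "inj_on u {..<n}"
      using strict_mono_on_imp_inj_on[OF x] by (auto simp: u_def inj_on_def)
    then have "d i = 0" if "i < n" for i
      using power_sums_eq_0_imp_eq_0[of u n d] that zero by auto
    then show False
      using c by (auto simp: d_def)
  qed
  then obtain k where "(\<Sum>i<n. d i * u i ^ k) \<noteq> 0"
    by blast
  then have "0 < suminf (\<lambda>k. (\<Sum>i<n. d i * u i ^ k)\<^sup>2 / fact k)"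
    using sums_summable[OF sums] by (intro suminf_pos2[of _ k]) auto
  then show "0 < ?Q"
    using sums_unique[OF sums] by simp
qed

lemma hankel_pd_imp_psd: "hankel_pd X g \<Longrightarrow> hankel_psd X g"
  unfolding hankel_psd_def
proof (intro allI impI)
  fix n :: nat and x c :: "nat \<Rightarrow> real"
  assume "hankel_pd X g" "strict_mono_on {..<n} x" "x \<in> {..<n} \<rightarrow> X"
  then show "0 \<le> (\<Sum>i<n. \<Sum>j<n. c i * c j * g ((x i + x j) / 2))"
    using hankel_pdD[of X g n x c] by (cases "\<exists>i<n. c i \<noteq> 0") auto
qed

lemma hankel_psd_add_pd:
  assumes "hankel_psd X g" "hankel_pd X h" "e > 0"
  shows "hankel_pd X (\<lambda>m. g m + e * h m)"
  unfolding hankel_pd_def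
proof (intro allI impI)
  fix n :: nat and x c :: "nat \<Rightarrow> real"
  assume x: "strict_mono_on {..<n} x" "x \<in> {..<n} \<rightarrow> X" and c: "\<exists>i<n. c i \<noteq> 0"
  let ?Q = "\<lambda>g. \<Sum>i<n. \<Sum>j<n. c i * c j * g ((x i + x j) / 2)"
  have "?Q (\<lambda>m. g m + e * h m) = ?Q g + e * ?Q h"
    by (simp add: sum.distrib sum_distrib_left algebra_simps)
  also have "\<dots> > 0"
    using hankel_psdD[OF assms(1) x] hankel_pdD[OF assms(2) x c] \<open>e > 0\<close>
    by (intro add_nonneg_pos) auto
  finally show "?Q (\<lambda>m. g m + e * h m) > 0" .
qed

lemma hankel_psd_minor_nonneg:
  assumes X: "open X" "is_interval X" and g: "hankel_psd X g" "continuous_on X g"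
    and x: "strict_mono_on {..<n} x" "x \<in> {..<n} \<rightarrow> X"
    and y: "strict_mono_on {..<n} y" "y \<in> {..<n} \<rightarrow> X"
  shows "fdet n (\<lambda>i j. g ((x i + y j) / 2)) \<ge> 0"
proof -
  define h where "h = (\<lambda>m::real. exp (2 * (m - 0)\<^sup>2))"
  have "(\<lambda>m. fdet n (\<lambda>i j. g ((x i + y j) / 2) + inverse (real (Suc m)) * h ((x i + y j) / 2)))
      \<longlonglongrightarrow> fdet n (\<lambda>i j. g ((x i + y j) / 2) + 0 * h ((x i + y j) / 2))"
    by (intro fdet_tendsto tendsto_intros LIMSEQ_inverse_real_of_nat)
  moreover have "0 < fdet n (\<lambda>i j. g ((x i + y j) / 2) + e * h ((x i + y j) / 2))" if "e > 0" for e
  proof (rule hankel_pd_minor_pos[OF X _ _ x y, where g = "\<lambda>m. g m + e * h m"])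
    show "hankel_pd X (\<lambda>m. g m + e * h m)"
      unfolding h_def by (rule hankel_psd_add_pd[OF g(1) hankel_pd_gauss that])
    show "continuous_on X (\<lambda>m. g m + e * h m)"
      unfolding h_def by (intro continuous_intros g(2))
  qed
  ultimately show ?thesis
    by (intro LIMSEQ_le_const[of "\<lambda>m. fdet n (\<lambda>i j. g ((x i + y j) / 2) + inverse (real (Suc m)) * h ((x i + y j) / 2))"])
      (auto intro!: less_imp_le exI[of _ 0])
qed

lemma hankel_gram:
  fixes g :: "real \<Rightarrow> real"
  assumes minors: "\<And>n x. strict_mono_on {..<n} x \<Longrightarrow> x \<in> {..<n} \<rightarrow> X
      \<Longrightarrow> fdet n (\<lambda>i j. g ((x i + x j) / 2)) \<ge> 0"
    and x: "strict_mono_on {..<n} x" "x \<in> {..<n} \<rightarrow> X"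
  obtains w :: "nat \<Rightarrow> nat \<Rightarrow> real"
  where "\<And>i j. i < n \<Longrightarrow> j < n \<Longrightarrow> g ((x i + x j) / 2) = (\<Sum>l<n. w l i * w l j)"
proof (rule gram_if_principal_minors_nonneg[of n "\<lambda>i j. g ((x i + x j) / 2)"])
  fix m and p :: "nat \<Rightarrow> nat"
  assume p: "strict_mono_on {..<m} p" "p \<in> {..<m} \<rightarrow> {..<n}"
  show "fdet m (\<lambda>i j. g ((x (p i) + x (p j)) / 2)) \<ge> 0"
  proof (rule minors)
    show "strict_mono_on {..<m} (\<lambda>i. x (p i))"
      using p by (intro strict_mono_onI strict_mono_onD[OF x(1)] strict_mono_onD[OF p(1)]) auto
    show "(\<lambda>i. x (p i)) \<in> {..<m} \<rightarrow> X"
      using p(2) x(2) by auto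
  qed
qed (use that in \<open>auto simp: add.commute\<close>)

lemma hankel_psd_if_minors_nonneg:
  fixes g :: "real \<Rightarrow> real"
  assumes minors: "\<And>n x. strict_mono_on {..<n} x \<Longrightarrow> x \<in> {..<n} \<rightarrow> X
      \<Longrightarrow> fdet n (\<lambda>i j. g ((x i + x j) / 2)) \<ge> 0"
  shows "hankel_psd X g"
  unfolding hankel_psd_def
proof (intro allI impI)
  fix n :: nat and x c :: "nat \<Rightarrow> real"
  assume x: "strict_mono_on {..<n} x" "x \<in> {..<n} \<rightarrow> X"
  obtain w where w: "\<And>i j. i < n \<Longrightarrow> j < n \<Longrightarrow> g ((x i + x j) / 2) = (\<Sum>l<n. w l i * w l j)"
    using hankel_gram[where g = g and X = X, OF minors x] by blast
  show "0 \<le> (\<Sum>i<n. \<Sum>j<n. c i * c j * g ((x i + x j) / 2))"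
    by (subst quadratic_form_gram[OF w]) (auto intro: sum_nonneg)
qed

text \<open>By the Gram factorisation the form is a sum of squares. If it vanishes, so do all
  pairings of \<open>c\<close> with the Gram vectors, and \<open>c\<close> lies in the kernel of a
  matrix with positive determinant.\<close>

lemma hankel_pd_if_minors_pos:
  fixes g :: "real \<Rightarrow> real"
  assumes minors: "\<And>n x. strict_mono_on {..<n} x \<Longrightarrow> x \<in> {..<n} \<rightarrow> X
      \<Longrightarrow> fdet n (\<lambda>i j. g ((x i + x j) / 2)) > 0"
  shows "hankel_pd X g"
  unfolding hankel_pd_def
proof (intro allI impI)
  fix n :: nat and x c :: "nat \<Rightarrow> real"
  assume x: "strict_mono_on {..<n} x" "x \<in> {..<n} \<rightarrow> X" and c: "\<exists>i<n. c i \<noteq> 0"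
  obtain w where w: "\<And>i j. i < n \<Longrightarrow> j < n \<Longrightarrow> g ((x i + x j) / 2) = (\<Sum>l<n. w l i * w l j)"
    using hankel_gram[where g = g and X = X, OF less_imp_le[OF minors] x] by blast
  let ?Q = "\<Sum>i<n. \<Sum>j<n. c i * c j * g ((x i + x j) / 2)"
  have Q: "?Q = (\<Sum>l<n. (\<Sum>i<n. c i * w l i)\<^sup>2)"
    by (rule quadratic_form_gram[OF w])
  have "?Q \<noteq> 0"
  proof
    assume "?Q = 0"
    then have zero: "(\<Sum>i<n. c i * w l i) = 0" if "l < n" for l
      unfolding Q using that by (subst (asm) sum_nonneg_eq_0_iff) auto
    have "(\<Sum>j<n. g ((x i + x j) / 2) * c j) = 0" if "i < n" for i
    proof -
      have "(\<Sum>j<n. g ((x i + x j) / 2) * c j) = (\<Sum>j<n. \<Sum>l<n. w l i * (c j * w l j))"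
        using that by (intro sum.cong refl) (simp add: w sum_distrib_left mult_ac)
      also have "\<dots> = (\<Sum>l<n. w l i * (\<Sum>j<n. c j * w l j))"
        unfolding sum_distrib_left by (rule sum.swap)
      also have "\<dots> = 0"
        using zero by simp
      finally show ?thesis .
    qed
    then have "fdet n (\<lambda>i j. g ((x i + x j) / 2)) = 0"
      unfolding fdet_eq_0_iff using c by blast
    then show False
      using minors[OF x] by simp
  qed
  moreover have "?Q \<ge> 0"
    unfolding Q by (intro sum_nonneg) simp
  ultimately show "0 < ?Q"
    by simp
qed

lemma strict_mono_on_singleton: "strict_mono_on {..<Suc 0} f"
  by (auto simp: strict_mono_on_def)

lemma hankel_psd_nonneg:
  assumes "hankel_psd X g" "m \<in> X"
  shows "g m \<ge> 0"
  using hankel_psdD[OF assms(1), of 1 "\<lambda>i. m + real i" "\<lambda>_. 1"] assms(2)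
  by (simp add: strict_mono_on_singleton)

lemma hankel_pd_pos:
  assumes "hankel_pd X g" "m \<in> X"
  shows "g m > 0"
  using hankel_pdD[OF assms(1), of 1 "\<lambda>i. m + real i" "\<lambda>_. 1"] assms(2)
  by (simp add: strict_mono_on_singleton)

lemma hankel_psd_const: "e \<ge> 0 \<Longrightarrow> hankel_psd X (\<lambda>_. e)"
  unfolding hankel_psd_def
proof (intro allI impI)
  fix n :: nat and x c :: "nat \<Rightarrow> real"
  assume "e \<ge> 0"
  have "(\<Sum>i<n. \<Sum>j<n. c i * c j * e) = e * (\<Sum>i<n. c i)\<^sup>2"
    by (simp add: power2_eq_square sum_product sum_distrib_left mult_ac)
  then show "0 \<le> (\<Sum>i<n. \<Sum>j<n. c i * c j * e)"
    using \<open>e \<ge> 0\<close> by simp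
qed

section \<open>Closure under products, powers and power series\<close>

context
  fixes X :: "real set"
  assumes X: "open X" "is_interval X"
begin

lemma hankel_psd_mult:
  assumes "hankel_psd X g" "hankel_psd X h" "continuous_on X h"
  shows "hankel_psd X (\<lambda>m. g m * h m)"
  unfolding hankel_psd_def
proof (intro allI impI)
  fix n :: nat and x c :: "nat \<Rightarrow> real"
  assume x: "strict_mono_on {..<n} x" "x \<in> {..<n} \<rightarrow> X"
  obtain w where w: "\<And>i j. i < n \<Longrightarrow> j < n \<Longrightarrow> h ((x i + x j) / 2) = (\<Sum>l<n. w l i * w l j)"
    using hankel_gram[where g = h and X = X, OF hankel_psd_minor_nonneg[OF X assms(2,3)] x] by blast
  have "(\<Sum>i<n. \<Sum>j<n. c i * c j * (g ((x i + x j) / 2) * h ((x i + x j) / 2)))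
      = (\<Sum>l<n. \<Sum>i<n. \<Sum>j<n. (c i * w l i) * (c j * w l j) * g ((x i + x j) / 2))"
    by (rule quadratic_form_schur_product[OF w])
  also have "\<dots> \<ge> 0"
    by (intro sum_nonneg hankel_psdD[OF assms(1) x])
  finally show "0 \<le> (\<Sum>i<n. \<Sum>j<n. c i * c j * (g ((x i + x j) / 2) * h ((x i + x j) / 2)))" .
qed

text \<open>Strictness: if \<open>c k \<noteq> 0\<close>, then \<open>h (x k) > 0\<close> is the sum
  of the squares of the \<open>w l k\<close>, so some rescaled vector is nonzero at
  \<open>k\<close>, and on it the form of \<open>g\<close> is positive.\<close>

lemma hankel_pd_mult:
  assumes "hankel_pd X g" "hankel_psd X h" "continuous_on X h" and pos: "\<And>m. m \<in> X \<Longrightarrow> h m > 0"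
  shows "hankel_pd X (\<lambda>m. g m * h m)"
  unfolding hankel_pd_def
proof (intro allI impI)
  fix n :: nat and x c :: "nat \<Rightarrow> real"
  assume x: "strict_mono_on {..<n} x" "x \<in> {..<n} \<rightarrow> X" and "\<exists>i<n. c i \<noteq> 0"
  then obtain k where k: "k < n" "c k \<noteq> 0"
    by blast
  obtain w where w: "\<And>i j. i < n \<Longrightarrow> j < n \<Longrightarrow> h ((x i + x j) / 2) = (\<Sum>l<n. w l i * w l j)"
    using hankel_gram[where g = h and X = X, OF hankel_psd_minor_nonneg[OF X assms(2,3)] x] by blast
  have "(\<Sum>l<n. w l k * w l k) > 0"
    using w[of k k] pos[of "x k"] x(2) k by auto
  then obtain l where l: "l < n" "w l k \<noteq> 0"
    by (metis (no_types, lifting) less_irrefl lessThan_iff mult_zero_left sum.neutral)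
  have "(\<Sum>i<n. \<Sum>j<n. c i * c j * (g ((x i + x j) / 2) * h ((x i + x j) / 2)))
      = (\<Sum>l<n. \<Sum>i<n. \<Sum>j<n. (c i * w l i) * (c j * w l j) * g ((x i + x j) / 2))"
    by (rule quadratic_form_schur_product[OF w])
  also have "\<dots> > 0"
  proof (rule sum_pos2[of _ l])
    show "0 < (\<Sum>i<n. \<Sum>j<n. (c i * w l i) * (c j * w l j) * g ((x i + x j) / 2))"
      using k l by (intro hankel_pdD[OF assms(1) x]) auto
    show "0 \<le> (\<Sum>i<n. \<Sum>j<n. (c i * w l i) * (c j * w l j) * g ((x i + x j) / 2))" for l
      by (intro hankel_psdD[OF hankel_pd_imp_psd[OF assms(1)] x])
  qed (use l in auto)
  finally show "0 < (\<Sum>i<n. \<Sum>j<n. c i * c j * (g ((x i + x j) / 2) * h ((x i + x j) / 2)))" .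
qed

lemma hankel_psd_power:
  assumes "hankel_psd X g" "continuous_on X g"
  shows "hankel_psd X (\<lambda>m. g m ^ k)"
proof (induction k)
  case 0
  then show ?case
    using hankel_psd_const[of 1] by simp
next
  case (Suc k)
  then show ?case
    using hankel_psd_mult[OF Suc assms] by (simp add: mult.commute)
qed

lemma hankel_pd_power:
  assumes "hankel_pd X g" "continuous_on X g" "k > 0"
  shows "hankel_pd X (\<lambda>m. g m ^ k)"
proof -
  obtain l where "k = Suc l"
    using \<open>k > 0\<close> gr0_implies_Suc by blast
  moreover have "hankel_pd X (\<lambda>m. g m * g m ^ l)"
    using assms hankel_pd_pos hankel_pd_imp_psd
    by (intro hankel_pd_mult hankel_psd_power continuous_intros) auto
  ultimately show ?thesis
    by simp
qed

lemma quadratic_form_power_series_sums: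
  fixes n :: nat and g h :: "real \<Rightarrow> real"
  assumes "\<And>m. m \<in> X \<Longrightarrow> (\<lambda>k. a k * g m ^ k) sums h m" and "x \<in> {..<n} \<rightarrow> X"
  shows "(\<lambda>k. a k * (\<Sum>i<n. \<Sum>j<n. c i * c j * g ((x i + x j) / 2) ^ k))
    sums (\<Sum>i<n. \<Sum>j<n. c i * c j * h ((x i + x j) / 2))"
proof -
  have "(\<lambda>k. \<Sum>i<n. \<Sum>j<n. c i * c j * (a k * g ((x i + x j) / 2) ^ k))
      sums (\<Sum>i<n. \<Sum>j<n. c i * c j * h ((x i + x j) / 2))"
    by (intro sums_sum sums_mult assms(1) midpoint_in_interval[OF X(2)]) (use assms(2) in auto)
  then show ?thesis
    by (simp add: sum_distrib_left mult_ac)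
qed

lemma hankel_psd_power_series:
  assumes g: "hankel_psd X g" "continuous_on X g" and a: "\<And>k. a k \<ge> 0"
    and h: "\<And>m. m \<in> X \<Longrightarrow> (\<lambda>k. a k * g m ^ k) sums h m"
  shows "hankel_psd X h"
  unfolding hankel_psd_def
proof (intro allI impI)
  fix n :: nat and x c :: "nat \<Rightarrow> real"
  assume x: "strict_mono_on {..<n} x" "x \<in> {..<n} \<rightarrow> X"
  have "0 \<le> a k * (\<Sum>i<n. \<Sum>j<n. c i * c j * g ((x i + x j) / 2) ^ k)" for k
    using a hankel_psdD[OF hankel_psd_power[OF g] x] by simp
  then show "0 \<le> (\<Sum>i<n. \<Sum>j<n. c i * c j * h ((x i + x j) / 2))"
    by (rule sums_le[OF _ sums_zero quadratic_form_power_series_sums[where c = c and a = a and g = g and h = h, OF h x(2)]])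
qed

lemma hankel_pd_power_series:
  assumes g: "hankel_pd X g" "continuous_on X g" and a: "\<And>k. a k \<ge> 0" "a k > 0" "k > 0"
    and h: "\<And>m. m \<in> X \<Longrightarrow> (\<lambda>k. a k * g m ^ k) sums h m"
  shows "hankel_pd X h"
  unfolding hankel_pd_def
proof (intro allI impI)
  fix n :: nat and x c :: "nat \<Rightarrow> real"
  assume x: "strict_mono_on {..<n} x" "x \<in> {..<n} \<rightarrow> X" and c: "\<exists>i<n. c i \<noteq> 0"
  let ?q = "\<lambda>k. a k * (\<Sum>i<n. \<Sum>j<n. c i * c j * g ((x i + x j) / 2) ^ k)"
  note sums = quadratic_form_power_series_sums[where c = c and a = a and g = g and h = h, OF h x(2)]
  have "0 < suminf ?q"
  proof (rule suminf_pos2)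
    show "0 \<le> ?q k" for k
      using a(1) hankel_psdD[OF hankel_psd_power[OF hankel_pd_imp_psd[OF g(1)] g(2)] x] by auto
    show "0 < ?q k"
      using a(2) hankel_pdD[OF hankel_pd_power[OF g a(3)] x c] by auto
  qed (use sums in \<open>rule sums_summable\<close>)
  then show "0 < (\<Sum>i<n. \<Sum>j<n. c i * c j * h ((x i + x j) / 2))"
    using sums_unique[OF sums] by simp
qed

text \<open>The bridge to the definitions on kernels, with \<open>g\<close> the diagonal of
  \<open>K\<close>. From kernel to form only principal minors are used; the way back yields all
  minors.\<close>

lemma cont_TN_hankel_kernels_iff:
  "K \<in> cont_TN_hankel_kernels X \<longleftrightarrow>
    (\<exists>g. continuous_on X g \<and> hankel_psd X g \<and> (\<forall>x\<in>X. \<forall>y\<in>X. K (x, y) = g ((x + y) / 2)))" (is "?L \<longleftrightarrow> ?R")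
  and cont_TP_hankel_kernels_iff:
  "K \<in> cont_TP_hankel_kernels X \<longleftrightarrow>
    (\<exists>g. continuous_on X g \<and> hankel_pd X g \<and> (\<forall>x\<in>X. \<forall>y\<in>X. K (x, y) = g ((x + y) / 2)))" (is "?L' \<longleftrightarrow> ?R'")
proof -
  have diagonal: "continuous_on X (\<lambda>x. K (x, x))" "\<And>x y. x \<in> X \<Longrightarrow> y \<in> X \<Longrightarrow> K (x, y) = K ((x + y) / 2, (x + y) / 2)"
    if K: "continuous_on (X \<times> X) K" "hankel_kernel X K"
  proof -
    show "continuous_on X (\<lambda>x. K (x, x))"
      by (rule continuous_on_compose2[OF K(1)]) (auto intro!: continuous_intros)
    obtain f where "\<And>x y. x \<in> X \<Longrightarrow> y \<in> X \<Longrightarrow> K (x, y) = f (x + y)"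
      using K(2) unfolding hankel_kernel_def by blast
    then show "K (x, y) = K ((x + y) / 2, (x + y) / 2)" if "x \<in> X" "y \<in> X" for x y
      using midpoint_in_interval[OF X(2) that] that by simp
  qed
  have hankel: "continuous_on (X \<times> X) K" "hankel_kernel X K"
    if g: "continuous_on X g" "\<forall>x\<in>X. \<forall>y\<in>X. K (x, y) = g ((x + y) / 2)" for g
  proof -
    have "continuous_on (X \<times> X) (\<lambda>z. g ((fst z + snd z) / 2))"
      using midpoint_in_interval[OF X(2)]
      by (intro continuous_on_compose2[OF g(1)] continuous_intros) auto
    then show "continuous_on (X \<times> X) K"
      by (rule continuous_on_cong[THEN iffD1, rotated -1]) (use g(2) in auto)
    show "hankel_kernel X K"
      unfolding hankel_kernel_def using g(2) by (intro exI[of _ "\<lambda>s. g (s / 2)"]) auto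
  qed
  have minor: "Determinant.det (Matrix.mat n n (\<lambda>(i, j). K (x i, y j))) = fdet n (\<lambda>i j. g ((x i + y j) / 2))"
    if "\<forall>x\<in>X. \<forall>y\<in>X. K (x, y) = g ((x + y) / 2)" "x \<in> {..<n} \<rightarrow> X" "y \<in> {..<n} \<rightarrow> X" for n g x y
    using fdet_cong[of n "\<lambda>i j. K (x i, y j)" "\<lambda>i j. g ((x i + y j) / 2)"] that by (auto simp: fdet_def)
  show "?L \<longleftrightarrow> ?R"
  proof
    assume ?L
    then have K: "continuous_on (X \<times> X) K" "hankel_kernel X K" "totally_nonnegative X K"
      by (auto simp: cont_TN_hankel_kernels_def)
    note K12 = diagonal[OF K(1,2)]
    have "hankel_psd X (\<lambda>x. K (x, x))"
    proof (rule hankel_psd_if_minors_nonneg)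
      show "0 \<le> fdet n (\<lambda>i j. K ((x i + x j) / 2, (x i + x j) / 2))"
        if "strict_mono_on {..<n} x" "x \<in> {..<n} \<rightarrow> X" for n x
      proof -
        have "0 \<le> Determinant.det (Matrix.mat n n (\<lambda>(i, j). K (x i, x j)))"
          using K(3) that unfolding totally_nonnegative_def by blast
        also have "\<dots> = fdet n (\<lambda>i j. K ((x i + x j) / 2, (x i + x j) / 2))"
          by (rule minor) (use K12(2) that in auto)
        finally show ?thesis .
      qed
    qed
    then show ?R
      using K12 by blast
  next
    assume ?R
    then obtain g where g: "continuous_on X g" "hankel_psd X g" "\<forall>x\<in>X. \<forall>y\<in>X. K (x, y) = g ((x + y) / 2)"
      by blast
    have "totally_nonnegative X K"
      unfolding totally_nonnegative_def using minor[OF g(3)] hankel_psd_minor_nonneg[OF X g(2,1)] by simp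
    then show ?L
      using hankel[OF g(1,3)] by (simp add: cont_TN_hankel_kernels_def)
  qed
  show "?L' \<longleftrightarrow> ?R'"
  proof
    assume ?L'
    then have K: "continuous_on (X \<times> X) K" "hankel_kernel X K" "totally_positive X K"
      by (auto simp: cont_TP_hankel_kernels_def)
    note K12 = diagonal[OF K(1,2)]
    have "hankel_pd X (\<lambda>x. K (x, x))"
    proof (rule hankel_pd_if_minors_pos)
      show "0 < fdet n (\<lambda>i j. K ((x i + x j) / 2, (x i + x j) / 2))"
        if "strict_mono_on {..<n} x" "x \<in> {..<n} \<rightarrow> X" for n x
      proof -
        have "0 < Determinant.det (Matrix.mat n n (\<lambda>(i, j). K (x i, x j)))"
          using K(3) that unfolding totally_positive_def by blast
        also have "\<dots> = fdet n (\<lambda>i j. K ((x i + x j) / 2, (x i + x j) / 2))"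
          by (rule minor) (use K12(2) that in auto)
        finally show ?thesis .
      qed
    qed
    then show ?R'
      using K12 by blast
  next
    assume ?R'
    then obtain g where g: "continuous_on X g" "hankel_pd X g" "\<forall>x\<in>X. \<forall>y\<in>X. K (x, y) = g ((x + y) / 2)"
      by blast
    have "totally_positive X K"
      unfolding totally_positive_def using minor[OF g(3)] hankel_pd_minor_pos[OF X g(2,1)] by simp
    then show ?L'
      using hankel[OF g(1,3)] by (simp add: cont_TP_hankel_kernels_def)
  qed
qed

end

section \<open>Absolutely monotone functions\<close>

text \<open>Polymorphic in the argument, so that one operator serves sequences with step 1 and real
  functions with step \<open>h\<close>.\<close>

definition forward_diff :: "'a::plus \<Rightarrow> ('a \<Rightarrow> real) \<Rightarrow> 'a \<Rightarrow> real" where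
  "forward_diff h F x = F (x + h) - F x"

section \<open>Bernstein polynomials in terms of forward differences\<close>

lemma Bernstein_Suc_Suc:
  "Bernstein (Suc n) (Suc k) x = x * Bernstein n k x + (1 - x) * Bernstein n (Suc k) x"
proof (cases "k < n")
  case True
  then have "n - k = Suc (n - Suc k)"
    by simp
  then show ?thesis
    by (simp add: Bernstein_def algebra_simps)
next
  case False
  then show ?thesis
    by (cases "k = n") (simp_all add: Bernstein_def binomial_eq_0)
qed

lemma Bernstein_sum_Suc:
  "(\<Sum>k\<le>Suc n. g k * Bernstein (Suc n) k x)
    = (1 - x) * (\<Sum>k\<le>n. g k * Bernstein n k x) + x * (\<Sum>k\<le>n. g (Suc k) * Bernstein n k x)"
proof -
  have "(\<Sum>k\<le>Suc n. g k * Bernstein (Suc n) k x)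
      = g 0 * Bernstein (Suc n) 0 x + (\<Sum>k\<le>n. g (Suc k) * Bernstein (Suc n) (Suc k) x)"
    by (rule sum.atMost_Suc_shift)
  also have "\<dots> = (1 - x) * (g 0 * Bernstein n 0 x + (\<Sum>k\<le>n. g (Suc k) * Bernstein n (Suc k) x))
      + x * (\<Sum>k\<le>n. g (Suc k) * Bernstein n k x)"
    unfolding Bernstein_Suc_Suc
    by (simp add: Bernstein_def[of _ 0] algebra_simps sum.distrib sum_distrib_left sum_subtractf)
  also have "g 0 * Bernstein n 0 x + (\<Sum>k\<le>n. g (Suc k) * Bernstein n (Suc k) x) = (\<Sum>k\<le>Suc n. g k * Bernstein n k x)"
    by (rule sum.atMost_Suc_shift[symmetric])
  also have "\<dots> = (\<Sum>k\<le>n. g k * Bernstein n k x)"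
    by (simp add: Bernstein_def)
  finally show ?thesis .
qed

text \<open>With the unit shift \<open>E\<close>, the Bernstein sum is
  \<open>((1 - x) + x E) ^ n = (1 + x (E - 1)) ^ n\<close> applied to \<open>g\<close> at 0, and the
  right-hand side is the binomial expansion. The induction peels off one factor and so passes to the
  difference of \<open>g\<close>.\<close>

lemma Bernstein_sum_forward_diff:
  fixes g :: "nat \<Rightarrow> real"
  shows "(\<Sum>k\<le>n. g k * Bernstein n k x) = (\<Sum>k\<le>n. real (n choose k) * (forward_diff 1 ^^ k) g 0 * x ^ k)"
proof (induction n arbitrary: g)
  case 0
  then show ?case
    by (simp add: Bernstein_def)
next
  case (Suc n)
  let ?R = "\<lambda>g. \<Sum>k\<le>n. real (n choose k) * (forward_diff 1 ^^ k) g 0 * x ^ k"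
  have step: "(forward_diff 1 ^^ Suc k) g 0 = (forward_diff 1 ^^ k) (forward_diff 1 g) 0" for k
    by (simp only: funpow_Suc_right o_apply)
  have "(\<Sum>k\<le>Suc n. g k * Bernstein (Suc n) k x)
      = (\<Sum>k\<le>n. g k * Bernstein n k x) + x * (\<Sum>k\<le>n. forward_diff 1 g k * Bernstein n k x)"
    unfolding Bernstein_sum_Suc
    by (simp add: forward_diff_def algebra_simps sum_subtractf)
  also have "\<dots> = ?R g + x * ?R (forward_diff 1 g)"
    by (simp only: Suc.IH)
  also have "?R g = (\<Sum>k\<le>Suc n. real (n choose k) * (forward_diff 1 ^^ k) g 0 * x ^ k)"
    by simp
  also have "\<dots> = g 0 + (\<Sum>k\<le>n. real (n choose Suc k) * (forward_diff 1 ^^ Suc k) g 0 * x ^ Suc k)"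
    by (subst sum.atMost_Suc_shift) simp
  also have "x * ?R (forward_diff 1 g) = (\<Sum>k\<le>n. real (n choose k) * (forward_diff 1 ^^ Suc k) g 0 * x ^ Suc k)"
    by (simp only: step sum_distrib_left power_Suc mult_ac)
  also have "g 0 + (\<Sum>k\<le>n. real (n choose Suc k) * (forward_diff 1 ^^ Suc k) g 0 * x ^ Suc k) + \<dots>
      = g 0 + (\<Sum>k\<le>n. real (Suc n choose Suc k) * (forward_diff 1 ^^ Suc k) g 0 * x ^ Suc k)"
    by (simp add: sum.distrib[symmetric] distrib_right add.commute del: funpow.simps power_Suc)
  also have "\<dots> = (\<Sum>k\<le>Suc n. real (Suc n choose k) * (forward_diff 1 ^^ k) g 0 * x ^ k)"
    by (subst sum.atMost_Suc_shift) simp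
  finally show ?case .
qed

lemma forward_diff_sample:
  "(forward_diff (1::nat) ^^ k) (\<lambda>j. F (x + real j * h)) j = (forward_diff h ^^ k) F (x + real j * h)"
  by (induction k arbitrary: j) (simp_all add: forward_diff_def algebra_simps)

lemma absolutely_monotone_approximation:
  fixes F :: "real \<Rightarrow> real"
  assumes cont: "continuous_on {0<..} F"
    and diff: "\<And>n h x. h > 0 \<Longrightarrow> x > 0 \<Longrightarrow> (forward_diff h ^^ n) F x \<ge> 0"
  shows "\<exists>a :: nat \<Rightarrow> real. \<exists>n. (\<forall>k. a k \<ge> 0) \<and> (\<forall>k>n. a k = 0) \<and>
    (\<forall>x. 0 \<le> x \<longrightarrow> x \<le> real (Suc m) \<longrightarrow> \<bar>F (x + inverse (Suc m)) - (\<Sum>k\<le>n. a k * x ^ k)\<bar> < inverse (Suc m))"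
proof -
  \<comment> \<open>\<open>M\<close> is at once the length of the interval, the reciprocal of its
    distance from 0 and the reciprocal of the error. The interval keeps away from 0 because
    continuity is only known on the open half-line.\<close>
  define M where "M = real (Suc m)"
  have M: "M > 0"
    by (simp add: M_def)
  define f where "f = (\<lambda>t. F (1 / M + t * M))"
  have "continuous_on {0..1} f"
    unfolding f_def
    by (intro continuous_on_compose2[OF cont] continuous_intros)
      (use M in \<open>auto intro!: add_pos_nonneg\<close>)
  from Bernstein_Weierstrass[OF this, of "inverse M"] M
  obtain N where N: "\<And>n x. N \<le> n \<Longrightarrow> x \<in> {0..1} \<Longrightarrow> \<bar>f x - (\<Sum>k\<le>n. f (real k / real n) * Bernstein n k x)\<bar> < inverse M"
    by auto
  define n where "n = Suc N"
  define h where "h = M / real n"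
  have h: "h > 0"
    using M by (simp add: h_def n_def)
  define a where "a = (\<lambda>k. real (n choose k) * (forward_diff h ^^ k) F (1 / M) / M ^ k)"
  have "\<bar>F (x + inverse M) - (\<Sum>k\<le>n. a k * x ^ k)\<bar> < inverse M" if x: "0 \<le> x" "x \<le> M" for x
  proof -
    have "(\<Sum>k\<le>n. f (real k / real n) * Bernstein n k (x / M))
        = (\<Sum>k\<le>n. F (1 / M + real k * h) * Bernstein n k (x / M))"
      by (simp add: f_def h_def)
    also have "\<dots> = (\<Sum>k\<le>n. real (n choose k) * (forward_diff h ^^ k) F (1 / M) * (x / M) ^ k)"
      using forward_diff_sample[of _ F "1 / M" h 0] by (simp add: Bernstein_sum_forward_diff)
    also have "\<dots> = (\<Sum>k\<le>n. a k * x ^ k)"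
      by (simp add: a_def power_divide)
    finally have "(\<Sum>k\<le>n. f (real k / real n) * Bernstein n k (x / M)) = (\<Sum>k\<le>n. a k * x ^ k)" .
    moreover have "f (x / M) = F (x + inverse M)"
      using M by (simp add: f_def inverse_eq_divide add.commute)
    moreover have "\<bar>f (x / M) - (\<Sum>k\<le>n. f (real k / real n) * Bernstein n k (x / M))\<bar> < inverse M"
      by (rule N) (use x M in \<open>auto simp: n_def\<close>)
    ultimately show ?thesis
      by simp
  qed
  moreover have "a k \<ge> 0" for k
    using diff[OF h, of "1 / M" k] M by (simp add: a_def)
  moreover have "a k = 0" if "k > n" for k
    using that by (simp add: a_def)
  ultimately show ?thesis
    unfolding M_def by blast
qed

section \<open>Limits of polynomials with non-negative coefficients\<close>

lemma diagonal_convergent_subsequence: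
  fixes a :: "nat \<Rightarrow> nat \<Rightarrow> real"
  assumes "\<And>m k. \<bar>a m k\<bar> \<le> M"
  obtains r where "strict_mono r" "\<And>k. convergent (\<lambda>i. a (r i) k)"
proof -
  interpret subseqs "\<lambda>k s. convergent (\<lambda>i. a (s i) k)"
  proof
    fix k and s :: "nat \<Rightarrow> nat"
    have "\<forall>i. a (s i) k \<in> {-M..M}"
      using assms by (auto simp: abs_le_iff minus_le_iff)
    then obtain l r where "strict_mono r" "((\<lambda>i. a (s i) k) \<circ> r) \<longlonglongrightarrow> l"
      using compact_imp_seq_compact[OF compact_Icc, THEN seq_compactE] by metis
    then show "\<exists>r'. strict_mono r' \<and> convergent (\<lambda>i. a ((s \<circ> r') i) k)"
      by (auto simp: convergent_def o_def)
  qed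
  have "convergent (\<lambda>i. a (diagseq i) k)" for k
  proof -
    \<comment> \<open>Only after its first \<open>Suc k\<close> terms is the diagonal sequence a
      subsequence of one chosen for coefficient \<open>k\<close>.\<close>
    have "convergent (\<lambda>i. a ((diagseq \<circ> (+) (Suc k)) i) k)"
    proof (rule diagseq_holds)
      fix r s :: "nat \<Rightarrow> nat" and n
      assume "strict_mono r" "convergent (\<lambda>i. a (s i) n)"
      then show "convergent (\<lambda>i. a ((s \<circ> r) i) n)"
        using convergent_subseq_convergent[of "\<lambda>i. a (s i) n" r] by (simp add: o_def)
    qed
    then show ?thesis
      using convergent_ignore_initial_segment[of "\<lambda>i. a (diagseq i) k" "Suc k"] by (simp add: add.commute)
  qed
  then show thesis
    using that subseq_diagseq by blast
qed

text \<open>As all terms are non-negative, each is bounded by the convergent sum. Hence the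
  coefficients are bounded, a subsequence converges for every \<open>k\<close>, and it remains to
  exchange limit and sum.\<close>

lemma power_series_if_polynomial_limit:
  fixes F :: "real \<Rightarrow> real" and a :: "nat \<Rightarrow> nat \<Rightarrow> real"
  assumes a: "\<And>m k. a m k \<ge> 0" and support: "\<And>m k. k > d m \<Longrightarrow> a m k = 0"
    and lim: "\<And>x. x > 0 \<Longrightarrow> (\<lambda>m. \<Sum>k\<le>d m. a m k * x ^ k) \<longlonglongrightarrow> F x"
  shows "\<exists>c. (\<forall>k. c k \<ge> 0) \<and> (\<forall>x>0. (\<lambda>k. c k * x ^ k) sums F x)"
proof -
  have "\<exists>M. \<forall>m k. a m k * x ^ k \<le> M" if x: "x > 0" for x
  proof -
    obtain M where M: "\<And>m. \<bar>\<Sum>k\<le>d m. a m k * x ^ k\<bar> \<le> M"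
      using convergent_imp_Bseq[OF convergentI[OF lim[OF x]]] by (auto simp: Bseq_def)
    have "a m k * x ^ k \<le> M" for m k
    proof (cases "k \<le> d m")
      case True
      have "a m k * x ^ k \<le> (\<Sum>k\<le>d m. a m k * x ^ k)"
        by (rule member_le_sum) (use True a x in auto)
      then show ?thesis
        using M[of m] by linarith
    next
      case False
      then show ?thesis
        using M[of m] support[of m k] by simp
    qed
    then show ?thesis by blast
  qed
  then obtain M where M: "\<And>x m k. x > 0 \<Longrightarrow> a m k * x ^ k \<le> M x"
    by metis
  have "\<bar>a m k\<bar> \<le> M 1" for m k
    using M[of 1 m k] a[of m k] by simp
  then obtain r where r: "strict_mono r" "\<And>k. convergent (\<lambda>i. a (r i) k)"
    using diagonal_convergent_subsequence[of a "M 1"] by blast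
  define c where "c = (\<lambda>k. lim (\<lambda>i. a (r i) k))"
  have c: "(\<lambda>i. a (r i) k) \<longlonglongrightarrow> c k" for k
    using r(2) by (simp add: c_def convergent_LIMSEQ_iff)
  have "(\<lambda>k. c k * x ^ k) sums F x" if x: "x > 0" for x
  proof -
    \<comment> \<open>Bounding the terms at \<open>2 * x\<close> instead of \<open>x\<close> gains a
      geometric factor, the summable majorant for Tannery's theorem.\<close>
    have bound: "norm (a (r i) k * x ^ k) \<le> M (2 * x) * (1 / 2) ^ k" for i k
    proof -
      have "a (r i) k * x ^ k = a (r i) k * (2 * x) ^ k * (1 / 2) ^ k"
        by (simp add: power_mult_distrib field_simps)
      also have "\<dots> \<le> M (2 * x) * (1 / 2) ^ k"
        using M[of "2 * x" "r i" k] x by (intro mult_right_mono) auto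
      finally show ?thesis
        using a[of "r i" k] x by simp
    qed
    have "eventually (\<lambda>(k, i). norm (a (r i) k * x ^ k) \<le> M (2 * x) * (1 / 2) ^ k) (at_top \<times>\<^sub>F sequentially)"
      using bound by (intro always_eventually) auto
    from tannerys_theorem[of "\<lambda>k i. a (r i) k * x ^ k", OF tendsto_mult_right[OF c] this]
    have tannery: "summable (\<lambda>k. norm (c k * x ^ k))"
      "(\<lambda>i. \<Sum>k. a (r i) k * x ^ k) \<longlonglongrightarrow> (\<Sum>k. c k * x ^ k)"
      by (auto intro!: summable_mult summable_geometric)
    have "(\<Sum>k. a m k * x ^ k) = (\<Sum>k\<le>d m. a m k * x ^ k)" for m
      by (rule suminf_finite) (use support in auto)
    then have "(\<lambda>i. \<Sum>k. a (r i) k * x ^ k) \<longlonglongrightarrow> F x"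
      using LIMSEQ_subseq_LIMSEQ[OF lim[OF x] r(1)] by (simp add: o_def)
    then have "F x = (\<Sum>k. c k * x ^ k)"
      using tannery(2) LIMSEQ_unique by blast
    then show ?thesis
      using summable_norm_cancel[OF tannery(1)] by (simp add: sums_iff)
  qed
  moreover have "c k \<ge> 0" for k
    using c a by (intro LIMSEQ_le_const[OF c]) auto
  ultimately show ?thesis
    by blast
qed

text \<open>
  The Bernstein polynomials of \<open>F\<close> on \<open>[1/m, m + 1/m]\<close>, expanded at the left end point, have forward
  differences of \<open>F\<close> as coefficients.
\<close>

theorem bernstein_absolutely_monotone:
  fixes F :: "real \<Rightarrow> real"
  assumes cont: "continuous_on {0<..} F"
    and diff: "\<And>n h x. h > 0 \<Longrightarrow> x > 0 \<Longrightarrow> (forward_diff h ^^ n) F x \<ge> 0"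
  shows "\<exists>c. (\<forall>k. c k \<ge> 0) \<and> (\<forall>x>0. (\<lambda>k. c k * x ^ k) sums F x)"
proof -
  have "\<forall>m. \<exists>a :: nat \<Rightarrow> real. \<exists>n. (\<forall>k. a k \<ge> 0) \<and> (\<forall>k>n. a k = 0) \<and>
    (\<forall>x. 0 \<le> x \<longrightarrow> x \<le> real (Suc m) \<longrightarrow> \<bar>F (x + inverse (Suc m)) - (\<Sum>k\<le>n. a k * x ^ k)\<bar> < inverse (Suc m))"
    using absolutely_monotone_approximation[OF assms] by blast
  then obtain a d where a: "\<And>m k. a m k \<ge> 0" "\<And>m k. k > d m \<Longrightarrow> a m k = (0::real)"
    and approx: "\<And>m x. 0 \<le> x \<Longrightarrow> x \<le> real (Suc m)
      \<Longrightarrow> \<bar>F (x + inverse (Suc m)) - (\<Sum>k\<le>d m. a m k * x ^ k)\<bar> < inverse (Suc m)"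
    by metis
  show ?thesis
  proof (rule power_series_if_polynomial_limit[OF a])
    fix x :: real assume x: "x > 0"
    have "isCont F x"
      using cont x by (simp add: continuous_on_eq_continuous_at)
    moreover have "(\<lambda>m. x + inverse (real (Suc m))) \<longlonglongrightarrow> x + 0"
      by (intro tendsto_intros LIMSEQ_inverse_real_of_nat)
    ultimately have F: "(\<lambda>m. F (x + inverse (Suc m))) \<longlonglongrightarrow> F x"
      by (intro isCont_tendsto_compose[of x F]) simp_all
    have "(\<lambda>m. F (x + inverse (Suc m)) - (\<Sum>k\<le>d m. a m k * x ^ k)) \<longlonglongrightarrow> 0"
    proof (rule Lim_null_comparison[OF _ LIMSEQ_inverse_real_of_nat])
      show "\<forall>\<^sub>F m in sequentially. norm (F (x + inverse (Suc m)) - (\<Sum>k\<le>d m. a m k * x ^ k)) \<le> inverse (real (Suc m))"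
        using eventually_ge_at_top[of "nat \<lceil>x\<rceil>"]
      proof eventually_elim
        case (elim m)
        then have "x \<le> real (Suc m)"
          by linarith
        then show ?case
          using approx[of x m] x by simp
      qed
    qed
    from tendsto_diff[OF F this] show "(\<lambda>m. \<Sum>k\<le>d m. a m k * x ^ k) \<longlonglongrightarrow> F x"
      by simp
  qed
qed

text \<open>The matrices with entries \<open>a + v i * v j\<close> have rank at most two: a constant
  kernel plus one exponential kernel. The summand \<open>a\<close> is the centre of the Taylor
  expansion and absorbs shifts of the argument.\<close>

definition rank_two_positive :: "(real \<Rightarrow> real) \<Rightarrow> bool" where
  "rank_two_positive F \<longleftrightarrow> (\<forall>a>0. \<forall>(n::nat) v c. strict_mono_on {..<n} v \<longrightarrow> (\<forall>i<n. v i > 0) \<longrightarrow>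
    0 \<le> (\<Sum>i<n. \<Sum>j<n. c i * c j * F (a + v i * v j)))"

lemma rank_two_positiveD:
  fixes n :: nat
  assumes "rank_two_positive F" "a > 0" "strict_mono_on {..<n} v" "\<forall>i<n. v i > 0"
  shows "0 \<le> (\<Sum>i<n. \<Sum>j<n. c i * c j * F (a + v i * v j))"
  using assms unfolding rank_two_positive_def by blast

text \<open>A moving integral, not divided by \<open>h\<close>, so that its derivative is exactly
  \<open>forward_diff h F\<close>. It looks only to the right and thus stays among positive
  arguments.\<close>

definition window_integral :: "real \<Rightarrow> (real \<Rightarrow> real) \<Rightarrow> real \<Rightarrow> real" where
  "window_integral h F x = integral {0..h} (\<lambda>t. F (x + t))"

lemma continuous_on_pos_shift:
  fixes F :: "real \<Rightarrow> real"
  assumes "continuous_on {0<..} F" "x > 0"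
  shows "continuous_on {0..h} (\<lambda>t. F (x + t))"
  by (intro continuous_on_compose2[OF assms(1)] continuous_intros) (use assms(2) in auto)

lemma has_real_derivative_forward_diff:
  assumes "\<And>x. x > 0 \<Longrightarrow> (G has_real_derivative G' x) (at x)" "h > 0" "x > 0"
  shows "(forward_diff h G has_real_derivative forward_diff h G' x) (at x)"
  unfolding forward_diff_def
  using assms by (auto intro!: derivative_eq_intros DERIV_shift[THEN iffD1])

lemma has_real_derivative_window_integral:
  assumes cont: "continuous_on {0<..} F" and "h > 0" "x > 0"
  shows "(window_integral h F has_real_derivative forward_diff h F x) (at x)"
proof -
  have "\<exists>G. \<forall>y. ereal 0 < ereal y \<longrightarrow> ereal y < \<infinity> \<longrightarrow> (G has_vector_derivative F y) (at y)"
    by (rule einterval_antiderivative) (use cont in \<open>auto simp: continuous_on_eq_continuous_at\<close>)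
  then obtain G where G: "\<And>y. y > 0 \<Longrightarrow> (G has_real_derivative F y) (at y)"
    by (auto simp: has_real_derivative_iff_has_vector_derivative)
  have eq: "window_integral h F y = forward_diff h G y" if "y > 0" for y
  proof -
    have "((\<lambda>t. F (y + t)) has_integral (G (y + h) - G (y + 0))) {0..h}"
    proof (rule fundamental_theorem_of_calculus)
      fix t assume "t \<in> {0..h}"
      then have "((\<lambda>t. G (y + t)) has_real_derivative F (y + t)) (at t)"
        using G[of "y + t"] that by (simp add: DERIV_shift add.commute[of y])
      then show "((\<lambda>t. G (y + t)) has_vector_derivative F (y + t)) (at t within {0..h})"
        by (simp add: has_real_derivative_iff_has_vector_derivative has_vector_derivative_at_within)
    qed (use \<open>h > 0\<close> in simp)
    then show ?thesis
      by (simp add: window_integral_def forward_diff_def integral_unique)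
  qed
  have "(forward_diff h G has_real_derivative forward_diff h F x) (at x)"
    using has_real_derivative_forward_diff[OF G \<open>h > 0\<close> \<open>x > 0\<close>] .
  then show ?thesis
    by (rule has_field_derivative_transform_within_open[of _ _ _ "{0<..}"])
      (use eq \<open>x > 0\<close> in auto)
qed

lemma continuous_on_window_integral:
  assumes "continuous_on {0<..} F" "h > 0"
  shows "continuous_on {0<..} (window_integral h F)"
  using has_real_derivative_window_integral[OF assms]
  by (auto intro!: continuous_at_imp_continuous_on DERIV_isCont)

text \<open>A shift by \<open>t \<ge> 0\<close> merely replaces \<open>a\<close> by
  \<open>a + t\<close>, so the form of the window integral is an integral of non-negative
  forms.\<close>

lemma rank_two_positive_window_integral:
  assumes F: "rank_two_positive F" "continuous_on {0<..} F" and "h > 0"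
  shows "rank_two_positive (window_integral h F)"
  unfolding rank_two_positive_def
proof (intro allI impI)
  fix a :: real and n :: nat and v c :: "nat \<Rightarrow> real"
  assume a: "a > 0" and v: "strict_mono_on {..<n} v" "\<forall>i<n. v i > 0"
  have "(\<lambda>t. F (a + v i * v j + t)) integrable_on {0..h}" if "i < n" "j < n" for i j
    using that v a by (intro integrable_continuous_interval continuous_on_pos_shift[OF F(2)] add_pos_pos mult_pos_pos) auto
  then have "((\<lambda>t. \<Sum>i<n. \<Sum>j<n. c i * c j * F (a + v i * v j + t)) has_integral
      (\<Sum>i<n. \<Sum>j<n. c i * c j * window_integral h F (a + v i * v j))) {0..h}"
    unfolding window_integral_def
    by (intro has_integral_sum has_integral_mult_right integrable_integral) auto
  moreover have "0 \<le> (\<Sum>i<n. \<Sum>j<n. c i * c j * F (a + v i * v j + t))" if "t \<in> {0..h}" for t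
  proof -
    have "0 \<le> (\<Sum>i<n. \<Sum>j<n. c i * c j * F ((a + t) + v i * v j))"
      by (rule rank_two_positiveD[OF F(1) _ v]) (use a that in auto)
    then show ?thesis
      by (simp add: add_ac)
  qed
  ultimately show "0 \<le> (\<Sum>i<n. \<Sum>j<n. c i * c j * window_integral h F (a + v i * v j))"
    by (rule has_integral_nonneg)
qed

lemma taylor_remainder:
  fixes diff :: "nat \<Rightarrow> real \<Rightarrow> real"
  assumes deriv: "\<And>k x. k < n \<Longrightarrow> x > 0 \<Longrightarrow> (diff k has_real_derivative diff (Suc k) x) (at x)"
    and "a > 0" "y > 0"
  shows "\<exists>\<xi>. a \<le> \<xi> \<and> \<xi> \<le> a + y \<and>
    diff 0 (a + y) = (\<Sum>k<n. diff k a / fact k * y ^ k) + diff n \<xi> / fact n * y ^ n"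
proof (cases "n = 0")
  \<comment> \<open>For \<open>n = 0\<close> the remainder is the whole value at
    \<open>a + y\<close>; this end point as witness is why the bounds on \<xi> are weak.\<close>
  case True
  then show ?thesis
    using assms by (intro exI[of _ "a + y"]) auto
next
  case False
  have "\<exists>t. a < t \<and> t < a + y \<and>
    diff 0 (a + y) = (\<Sum>k<n. diff k a / fact k * (a + y - a) ^ k) + diff n t / fact n * (a + y - a) ^ n"
    by (rule Taylor_up[where a = a]) (use False assms in auto)
  then obtain t where "a < t" "t < a + y"
    "diff 0 (a + y) = (\<Sum>k<n. diff k a / fact k * (a + y - a) ^ k) + diff n t / fact n * (a + y - a) ^ n"
    by blast
  then show ?thesis
    by (intro exI[of _ t]) simp
qed

text \<open>The \<open>n\<close> moment conditions on \<open>Suc n\<close> unknowns are padded with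
  a zero row to a singular square matrix. A kernel vector that also annihilated the
  \<open>n\<close>-th powers would be zero.\<close>

lemma exists_annihilator_of_lower_powers:
  fixes u :: "nat \<Rightarrow> real"
  assumes u: "inj_on u {..<Suc n}"
  obtains c where "\<And>k. k < n \<Longrightarrow> (\<Sum>i<Suc n. c i * u i ^ k) = 0" "(\<Sum>i<Suc n. c i * u i ^ n) \<noteq> 0"
proof -
  define A where "A = (\<lambda>k j. if k < n then u j ^ k else 0)"
  have "fdet (Suc n) A = 0"
    by (subst fdet_laplace_row[of n]) (simp_all add: A_def)
  then obtain c where c: "\<exists>j<Suc n. c j \<noteq> 0" "\<forall>k<Suc n. (\<Sum>j<Suc n. A k j * c j) = 0"
    unfolding fdet_eq_0_iff by blast
  have zero: "(\<Sum>i<Suc n. c i * u i ^ k) = 0" if "k < n" for k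
    using c(2)[rule_format, of k] that by (simp add: A_def mult.commute del: sum.lessThan_Suc)
  moreover have "(\<Sum>i<Suc n. c i * u i ^ n) \<noteq> 0"
  proof
    assume "(\<Sum>i<Suc n. c i * u i ^ n) = 0"
    then have "(\<Sum>i<Suc n. c i * u i ^ k) = 0" if "k < Suc n" for k
      using zero that by (cases "k = n") auto
    then show False
      using power_sums_eq_0_imp_eq_0[OF u] c(1) by blast
  qed
  ultimately show thesis
    using that by blast
qed

text \<open>
  Testing positivity of \<open>F(a + t\<^sup>2 u\<^sub>i u\<^sub>j)\<close> on a vector orthogonal to all powers of \<open>u\<close> below the
  \<open>n\<close>-th leaves the \<open>n\<close>-th derivative as the leading Taylor coefficient when \<open>t\<close> tends to \<open>0\<close>.
\<close>

lemma rank_two_positive_derivative_nonneg: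
  fixes diff :: "nat \<Rightarrow> real \<Rightarrow> real"
  assumes F: "rank_two_positive (diff 0)"
    and deriv: "\<And>k x. k < n \<Longrightarrow> x > 0 \<Longrightarrow> (diff k has_real_derivative diff (Suc k) x) (at x)"
    and cont: "continuous_on {0<..} (diff n)" and a: "a > 0"
  shows "diff n a \<ge> 0"
proof -
  define N where "N = Suc n"
  define u where "u = (\<lambda>i. real (Suc i))"
  have u_pos: "u i > 0" for i
    by (simp add: u_def)
  have "inj_on u {..<Suc n}"
    by (simp add: u_def inj_on_def)
  then obtain c where c: "\<And>k. k < n \<Longrightarrow> (\<Sum>i<N. c i * u i ^ k) = 0" "(\<Sum>i<N. c i * u i ^ n) \<noteq> 0"
    unfolding N_def using exists_annihilator_of_lower_powers by metis
  have moment: "(\<Sum>i<N. \<Sum>j<N. c i * c j * (u i * u j) ^ k) = (\<Sum>i<N. c i * u i ^ k)\<^sup>2" for k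
    by (simp add: power2_eq_square sum_product power_mult_distrib mult_ac)
  have "\<forall>y. \<exists>\<xi>. y > 0 \<longrightarrow> a \<le> \<xi> \<and> \<xi> \<le> a + y \<and>
      diff 0 (a + y) = (\<Sum>k<n. diff k a / fact k * y ^ k) + diff n \<xi> / fact n * y ^ n"
    using taylor_remainder[of n diff a, OF deriv a] by blast
  from choice[OF this] obtain \<xi> where \<xi>: "\<And>y. y > 0 \<Longrightarrow> a \<le> \<xi> y" "\<And>y. y > 0 \<Longrightarrow> \<xi> y \<le> a + y"
    and taylor: "\<And>y. y > 0 \<Longrightarrow> diff 0 (a + y) = (\<Sum>k<n. diff k a / fact k * y ^ k) + diff n (\<xi> y) / fact n * y ^ n"
    by blast
  \<comment> \<open>The remainder part of the form, without the common positive factor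
    \<open>(t\<^sup>2) ^ n / fact n\<close>.\<close>
  define S where "S = (\<lambda>t. \<Sum>i<N. \<Sum>j<N. c i * c j * (u i * u j) ^ n * diff n (\<xi> (t\<^sup>2 * (u i * u j))))"
  have S_nonneg: "S t \<ge> 0" if t: "t > 0" for t
  proof -
    have pos: "t\<^sup>2 * (u i * u j) > 0" for i j
      using t u_pos by simp
    have "0 \<le> (\<Sum>i<N. \<Sum>j<N. c i * c j * diff 0 (a + (t * u i) * (t * u j)))"
    proof -
      have "strict_mono_on {..<N} (\<lambda>i. t * u i)"
        using t by (auto simp: strict_mono_on_def u_def)
      then show ?thesis
        using t u_pos by (intro rank_two_positiveD[OF F a]) auto
    qed
    also have "\<dots> = (\<Sum>i<N. \<Sum>j<N. c i * c j * diff 0 (a + t\<^sup>2 * (u i * u j)))"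
      by (simp add: power2_eq_square mult_ac)
    also have "\<dots> = (\<Sum>i<N. \<Sum>j<N. (\<Sum>k<n. diff k a / fact k * (t\<^sup>2) ^ k * (c i * c j * (u i * u j) ^ k))
        + (t\<^sup>2) ^ n / fact n * (c i * c j * (u i * u j) ^ n * diff n (\<xi> (t\<^sup>2 * (u i * u j)))))"
      by (intro sum.cong refl, subst taylor[OF pos])
        (simp add: distrib_left sum_distrib_left power_mult_distrib mult_ac)
    also have "\<dots> = (\<Sum>i<N. \<Sum>j<N. \<Sum>k<n. diff k a / fact k * (t\<^sup>2) ^ k * (c i * c j * (u i * u j) ^ k))
        + (t\<^sup>2) ^ n / fact n * S t"
      unfolding S_def sum_distrib_left by (simp only: sum.distrib)
    \<comment> \<open>The orders \<open>k < n\<close> contribute squares of the moments of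
      \<open>c\<close>, which are zero by the choice of \<open>c\<close>.\<close>
    also have "(\<Sum>i<N. \<Sum>j<N. \<Sum>k<n. diff k a / fact k * (t\<^sup>2) ^ k * (c i * c j * (u i * u j) ^ k))
        = (\<Sum>k<n. diff k a / fact k * (t\<^sup>2) ^ k * (\<Sum>i<N. c i * u i ^ k)\<^sup>2)"
    proof -
      have "(\<Sum>i<N. \<Sum>j<N. \<Sum>k<n. diff k a / fact k * (t\<^sup>2) ^ k * (c i * c j * (u i * u j) ^ k))
          = (\<Sum>i<N. \<Sum>k<n. \<Sum>j<N. diff k a / fact k * (t\<^sup>2) ^ k * (c i * c j * (u i * u j) ^ k))"
        by (intro sum.cong refl sum.swap)
      also have "\<dots> = (\<Sum>k<n. \<Sum>i<N. \<Sum>j<N. diff k a / fact k * (t\<^sup>2) ^ k * (c i * c j * (u i * u j) ^ k))"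
        by (rule sum.swap)
      also have "\<dots> = (\<Sum>k<n. diff k a / fact k * (t\<^sup>2) ^ k * (\<Sum>i<N. c i * u i ^ k)\<^sup>2)"
        unfolding moment[symmetric] sum_distrib_left ..
      finally show ?thesis .
    qed
    also have "\<dots> = 0"
      by (intro sum.neutral) (simp add: c(1))
    finally have "0 \<le> (t\<^sup>2) ^ n / fact n * S t"
      by simp
    moreover have "(t\<^sup>2) ^ n / fact n > 0"
      using t by simp
    ultimately show ?thesis
      by (meson mult_pos_neg not_less)
  qed
  have "(\<lambda>m. S (inverse (real (Suc m)))) \<longlonglongrightarrow> (\<Sum>i<N. \<Sum>j<N. c i * c j * (u i * u j) ^ n * diff n a)"
    unfolding S_def
  proof (intro tendsto_sum tendsto_mult tendsto_const)
    fix i j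
    let ?y = "\<lambda>m. (inverse (real (Suc m)))\<^sup>2 * (u i * u j)"
    have y: "?y m > 0" for m
      using u_pos by simp
    have "(\<lambda>m. a + ?y m) \<longlonglongrightarrow> a + 0\<^sup>2 * (u i * u j)"
      by (intro tendsto_intros LIMSEQ_inverse_real_of_nat)
    then have "(\<lambda>m. \<xi> (?y m)) \<longlonglongrightarrow> a"
      by (intro tendsto_sandwich[of "\<lambda>_. a" "\<lambda>m. \<xi> (?y m)" _ "\<lambda>m. a + ?y m"])
        (simp_all only: \<xi>[OF y] tendsto_const eventually_True power_zero_numeral mult_zero_left add_0_right)
    moreover have "isCont (diff n) a"
      using cont a by (simp add: continuous_on_eq_continuous_at)
    ultimately show "(\<lambda>m. diff n (\<xi> (?y m))) \<longlonglongrightarrow> diff n a"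
      using isCont_tendsto_compose by blast
  qed
  then have "0 \<le> (\<Sum>i<N. \<Sum>j<N. c i * c j * (u i * u j) ^ n * diff n a)"
    by (rule LIMSEQ_le_const) (auto intro!: exI[of _ 0] S_nonneg)
  also have "\<dots> = (\<Sum>i<N. c i * u i ^ n)\<^sup>2 * diff n a"
    unfolding moment[symmetric] by (simp add: sum_distrib_right)
  finally show ?thesis
    using c(2) by (simp add: zero_le_mult_iff)
qed

text \<open>Each derivative trades one window integral for one forward difference, so the
  \<open>k\<close>-th derivative of \<open>W n\<close> is the \<open>k\<close>-th difference of
  \<open>W (n - k)\<close>. At \<open>k = n\<close> no integral is left and the derivative result
  speaks about \<open>F\<close> itself.\<close>

lemma rank_two_positive_forward_diff_nonneg:
  assumes F: "rank_two_positive F" "continuous_on {0<..} F" and h: "h > 0" and x: "x > 0"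
  shows "(forward_diff h ^^ n) F x \<ge> 0"
proof -
  define W where "W = (\<lambda>k. (window_integral h ^^ k) F)"
  have W: "continuous_on {0<..} (W k)" "rank_two_positive (W k)" for k
    by (induction k)
      (auto simp: W_def F intro: continuous_on_window_integral rank_two_positive_window_integral h)
  define diff where "diff = (\<lambda>k. (forward_diff h ^^ k) (W (n - k)))"
  have iterate: "((forward_diff h ^^ k) G has_real_derivative (forward_diff h ^^ k) G' y) (at y)"
    if "\<And>y. y > 0 \<Longrightarrow> (G has_real_derivative G' y) (at y)" "y > 0" for k G G' y
    using that
  proof (induction k arbitrary: y)
    case (Suc k)
    then show ?case
      using has_real_derivative_forward_diff[OF Suc.IH h] by simp
  qed simp
  have "diff n x \<ge> 0"
  proof (rule rank_two_positive_derivative_nonneg[where diff = diff])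
    show "rank_two_positive (diff 0)"
      by (simp add: diff_def W)
    show "(diff k has_real_derivative diff (Suc k) y) (at y)" if "k < n" "y > 0" for k y
    proof -
      have "W (n - k) = window_integral h (W (n - Suc k))"
        using that(1) by (simp add: W_def Suc_diff_Suc[symmetric])
      then have "((forward_diff h ^^ k) (W (n - k)) has_real_derivative
          (forward_diff h ^^ k) (forward_diff h (W (n - Suc k))) y) (at y)"
        using iterate[OF has_real_derivative_window_integral[OF W(1) h] that(2)] by simp
      then show ?thesis
        by (simp add: diff_def funpow_swap1)
    qed
    have forward_diff_abs: "forward_diff h G = (\<lambda>y. G (y + h) - G y)" for G
      by (simp add: forward_diff_def fun_eq_iff)
    have "continuous_on {0<..} ((forward_diff h ^^ k) F)" for k
    proof (induction k)
      case (Suc k)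
      have "continuous_on {0<..} (\<lambda>y. (forward_diff h ^^ k) F (y + h))"
        by (intro continuous_on_compose2[OF Suc.IH] continuous_intros) (use h in auto)
      then show ?case
        unfolding funpow.simps o_apply forward_diff_abs[of "(forward_diff h ^^ k) F"]
        by (rule continuous_on_diff[OF _ Suc.IH])
    qed (simp add: F)
    then show "continuous_on {0<..} (diff n)"
      by (simp add: diff_def W_def)
  qed (rule x)
  then show ?thesis
    by (simp add: diff_def W_def)
qed

section \<open>Transforms of Hankel kernels\<close>

lemma hankel_psd_exp: "hankel_psd X (\<lambda>m. exp (2 * (s * (m - t))))"
  unfolding hankel_psd_def
proof (intro allI impI)
  fix n :: nat and x c :: "nat \<Rightarrow> real"
  have "exp (2 * (s * ((x i + x j) / 2 - t))) = exp (s * (x i - t)) * exp (s * (x j - t))" for i j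
    by (simp add: field_simps flip: exp_add)
  then have "(\<Sum>i<n. \<Sum>j<n. c i * c j * exp (2 * (s * ((x i + x j) / 2 - t)))) = (\<Sum>i<n. c i * exp (s * (x i - t)))\<^sup>2"
    by (simp add: power2_eq_square sum_product mult_ac)
  then show "0 \<le> (\<Sum>i<n. \<Sum>j<n. c i * c j * exp (2 * (s * ((x i + x j) / 2 - t))))"
    by simp
qed

lemma hankel_psd_add:
  assumes "hankel_psd X g" "hankel_psd X h"
  shows "hankel_psd X (\<lambda>m. g m + h m)"
  using assms unfolding hankel_psd_def by (simp add: distrib_left sum.distrib)

lemma hankel_pd_not_constant:
  assumes "hankel_pd X g" "open X" "X \<noteq> {}"
  shows "\<not> g constant_on X"
proof
  assume "g constant_on X"
  then obtain e where e: "\<And>m. m \<in> X \<Longrightarrow> g m = e"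
    by (auto simp: constant_on_def)
  obtain x0 where "x0 \<in> X"
    using \<open>X \<noteq> {}\<close> by blast
  then obtain d where d: "d > 0" "ball x0 d \<subseteq> X"
    using \<open>open X\<close> openE by blast
  define x where "x = (\<lambda>i::nat. x0 + real i * (d / 2))"
  have x: "strict_mono_on {..<2} x" "x \<in> {..<2} \<rightarrow> X"
    using d by (auto simp: x_def strict_mono_on_def subset_iff dist_real_def less_2_cases_iff)
  have "(x i + x j) / 2 \<in> X" if "i < 2" "j < 2" for i j
    using that d by (auto simp: x_def subset_iff dist_real_def less_2_cases_iff field_simps)
  \<comment> \<open>On a constant function the coefficients 1 and -1 give the form the value
    0.\<close>
  moreover define c :: "nat \<Rightarrow> real" where "c = (\<lambda>i. if i = 0 then 1 else -1)"
  moreover have "\<exists>i<2. c i \<noteq> 0"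
    by (intro exI[of _ 0]) (simp add: c_def)
  ultimately show False
    using hankel_pdD[OF assms(1) x, of c] e by (simp add: numeral_2_eq_2)
qed

context
  fixes X :: "real set"
  assumes X: "open X" "is_interval X" and nonempty: "X \<noteq> {}"
begin

lemma cont_TP_subset_cont_TN: "cont_TP_hankel_kernels X \<subseteq> cont_TN_hankel_kernels X"
proof
  fix K assume "K \<in> cont_TP_hankel_kernels X"
  then obtain g where "continuous_on X g" "hankel_pd X g" "\<forall>x\<in>X. \<forall>y\<in>X. K (x, y) = g ((x + y) / 2)"
    unfolding cont_TP_hankel_kernels_iff[OF X] by blast
  then show "K \<in> cont_TN_hankel_kernels X"
    unfolding cont_TN_hankel_kernels_iff[OF X] by (blast intro: hankel_pd_imp_psd)
qed

lemma hankel_kernel_in_cont_TN: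
  assumes "continuous_on X g" "hankel_psd X g"
  shows "(\<lambda>(x, y). g ((x + y) / 2)) \<in> cont_TN_hankel_kernels X"
  unfolding cont_TN_hankel_kernels_iff[OF X] using assms by auto

lemma hankel_kernel_in_cont_TP:
  assumes "continuous_on X g" "hankel_pd X g"
  shows "(\<lambda>(x, y). g ((x + y) / 2)) \<in> cont_TP_hankel_kernels X"
  unfolding cont_TP_hankel_kernels_iff[OF X] using assms by auto

lemma compose_hankel_kernel_TN_imp:
  assumes "F \<circ> (\<lambda>(x, y). g ((x + y) / 2)) \<in> cont_TN_hankel_kernels X"
  shows "continuous_on X (\<lambda>m. F (g m))" "hankel_psd X (\<lambda>m. F (g m))"
proof -
  obtain h where h: "continuous_on X h" "hankel_psd X h"
    "\<forall>x\<in>X. \<forall>y\<in>X. (F \<circ> (\<lambda>(x, y). g ((x + y) / 2))) (x, y) = h ((x + y) / 2)"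
    using assms unfolding cont_TN_hankel_kernels_iff[OF X] by blast
  have eq: "F (g m) = h m" if "m \<in> X" for m
    using h(3)[rule_format, OF that that] by simp
  show "continuous_on X (\<lambda>m. F (g m))"
    using h(1) eq by (metis (no_types, lifting) continuous_on_cong)
  show "hankel_psd X (\<lambda>m. F (g m))"
    unfolding hankel_psd_def
  proof (intro allI impI)
    fix n :: nat and x c :: "nat \<Rightarrow> real"
    assume x: "strict_mono_on {..<n} x" "x \<in> {..<n} \<rightarrow> X"
    have "(\<Sum>i<n. \<Sum>j<n. c i * c j * F (g ((x i + x j) / 2))) = (\<Sum>i<n. \<Sum>j<n. c i * c j * h ((x i + x j) / 2))"
      by (intro sum.cong refl arg_cong2[where f = "(*)"] eq midpoint_in_interval[OF X(2)]) (use x(2) in auto)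
    then show "0 \<le> (\<Sum>i<n. \<Sum>j<n. c i * c j * F (g ((x i + x j) / 2)))"
      using hankel_psdD[OF h(2) x] by simp
  qed
qed

text \<open>A 2 by 2 minor bounds the square of \<open>g ((x + y) / 2)\<close> by
  \<open>g x * g y\<close>, so zeros pass to midpoints and the zero set is open as well as
  relatively closed. Consequently \<open>F 0\<close> matters for the zero kernel only.\<close>

lemma hankel_psd_zero_imp_zero:
  assumes g: "hankel_psd X g" "continuous_on X g" and p: "p \<in> X" "g p = 0" and q: "q \<in> X"
  shows "g q = 0"
proof -
  have midpoint: "g ((x + y) / 2) = 0" if xy: "x \<in> X" "y \<in> X" "g x = 0" for x y
  proof (cases "x = y")
    case False
    define z where "z = (\<lambda>i::nat. if i = 0 then min x y else max x y)"
    have z: "strict_mono_on {..<2} z" "z \<in> {..<2} \<rightarrow> X"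
      using xy False by (auto simp: z_def strict_mono_on_def min_def max_def less_2_cases_iff)
    have "0 \<le> fdet 2 (\<lambda>i j. g ((z i + z j) / 2))"
      by (rule hankel_psd_minor_nonneg[OF X g z z])
    also have "\<dots> = g x * g y - (g ((x + y) / 2))\<^sup>2"
      by (auto simp: fdet_2 z_def min_def max_def power2_eq_square add.commute)
    finally show ?thesis
      using xy by simp
  qed (use xy in simp)
  define Z where "Z = {x \<in> X. g x = 0}"
  have "open Z"
    unfolding open_dist
  proof
    fix x assume x: "x \<in> Z"
    then obtain d where d: "d > 0" "ball x d \<subseteq> X"
      using X(1) openE by (auto simp: Z_def)
    have "y \<in> Z" if "dist y x < d / 2" for y
    proof -
      \<comment> \<open>\<open>y\<close> is the midpoint of \<open>x\<close> and the mirror image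
        \<open>2 * y - x\<close>, which is still in \<open>X\<close> when \<open>y\<close> is close
        to \<open>x\<close>.\<close>
      have "2 * y - x \<in> ball x d" "y \<in> ball x d"
        using that d(1) by (auto simp: dist_real_def abs_if split: if_splits)
      then have "2 * y - x \<in> X" "y \<in> X"
        using d(2) by auto
      then show ?thesis
        using midpoint[of x "2 * y - x"] x by (simp add: Z_def)
    qed
    then show "\<exists>e>0. \<forall>y. dist y x < e \<longrightarrow> y \<in> Z"
      using d(1) by (intro exI[of _ "d / 2"]) auto
  qed
  moreover have "open (X \<inter> g -` (- {0}))"
    by (rule continuous_open_preimage[OF g(2) X(1)]) auto
  moreover have "X \<inter> g -` (- {0}) = X - Z"
    by (auto simp: Z_def)
  moreover have "connected X"
    using X(2) is_interval_connected by blast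
  ultimately show ?thesis
    using connectedD[of X Z "X - Z"] p q by (auto simp: Z_def)
qed

text \<open>Only totally positive test kernels are used, so that the argument serves both equivalences.\<close>

context
  fixes F :: "real \<Rightarrow> real"
  assumes F: "\<And>K. K \<in> cont_TP_hankel_kernels X \<Longrightarrow> F \<circ> K \<in> cont_TN_hankel_kernels X"
begin

text \<open>One Gaussian kernel suffices: its diagonal \<open>g\<close> takes the value
  \<open>t\<close> at \<open>x0\<close> and has a continuous right inverse \<psi> near
  \<open>t\<close>, so \<open>F\<close> agrees there with \<open>F\<close> after \<open>g\<close>
  after \<psi>.\<close>

lemma transform_continuous: "continuous_on {0<..} F"
proof (rule continuous_at_imp_continuous_on, rule ballI)
  fix t :: real assume "t \<in> {0<..}"
  then have t: "t > 0" by simp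
  obtain x0 where x0: "x0 \<in> X"
    using nonempty by blast
  \<comment> \<open>A centre one unit to the left makes the Gaussian strictly increasing at
    \<open>x0\<close>. The exponent at \<open>x0\<close> is 2, so the factor \<open>C\<close>
    normalises \<open>g x0\<close> to \<open>t\<close>.\<close>
  define p where "p = x0 - 1"
  define C where "C = t * exp (-2)"
  have C: "C > 0"
    using t by (simp add: C_def)
  define g where "g = (\<lambda>m. 0 + C * exp (2 * (m - p)\<^sup>2))"
  have "hankel_pd X g"
    unfolding g_def using hankel_psd_const[of 0] by (intro hankel_psd_add_pd hankel_pd_gauss C) simp
  moreover have "continuous_on X g"
    unfolding g_def by (intro continuous_intros)
  ultimately have "continuous_on X (\<lambda>m. F (g m))"
    by (intro compose_hankel_kernel_TN_imp(1)[OF F[OF hankel_kernel_in_cont_TP]])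
  then have cont: "isCont (\<lambda>m. F (g m)) x0"
    using X(1) x0 by (simp add: continuous_on_eq_continuous_at)
  define \<psi> where "\<psi> = (\<lambda>s. p + sqrt (ln (s / C) / 2))"
  have ln_t: "ln (t / C) = 2"
    using t by (simp add: C_def exp_minus inverse_eq_divide)
  have \<psi>_t: "\<psi> t = x0"
    by (simp add: \<psi>_def ln_t p_def)
  have "isCont \<psi> t"
    unfolding \<psi>_def using t C by (intro continuous_intros) auto
  then have "isCont (\<lambda>s. F (g (\<psi> s))) t"
    using isCont_o2[of t \<psi> "\<lambda>m. F (g m)"] cont \<psi>_t by simp
  moreover have "\<forall>\<^sub>F s in nhds t. F (g (\<psi> s)) = F s"
  proof -
    have "t > C"
      using t by (simp add: C_def)
    then have "\<forall>\<^sub>F s in nhds t. s > C"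
      using eventually_nhds_in_open[of "{C<..}" t] by simp
    then show ?thesis
    proof eventually_elim
      case (elim s)
      then have "ln (s / C) \<ge> 0" "s / C > 0"
        using C by auto
      then have "g (\<psi> s) = s"
        using C by (simp add: g_def \<psi>_def)
      then show ?case by simp
    qed
  qed
  ultimately show "isCont F t"
    using isCont_cong[of "\<lambda>s. F (g (\<psi> s))" F t] by simp
qed

lemma transform_rank_two_positive: "rank_two_positive F"
  unfolding rank_two_positive_def
proof (intro allI impI)
  fix a :: real and n :: nat and v c :: "nat \<Rightarrow> real"
  assume a: "a > 0" and v: "strict_mono_on {..<n} v" "\<forall>i<n. v i > 0"
  obtain x0 where x0: "x0 \<in> X"
    using nonempty by blast
  \<comment> \<open>For small \<open>d\<close> the points \<open>x0 + d * ln (v i)\<close> fit into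
    \<open>X\<close>, however large the spread of \<open>v\<close>; the exponential with rate
    \<open>1 / d\<close> below recovers \<open>v i * v j\<close> from their midpoints.\<close>
  have "\<forall>\<^sub>F d in at_right 0. \<forall>i\<in>{..<n}. x0 + d * ln (v i) \<in> X"
  proof (intro eventually_ball_finite ballI)
    fix i
    have "((\<lambda>d. x0 + d * ln (v i)) \<longlongrightarrow> x0) (at_right 0)"
      by (auto intro!: tendsto_eq_intros)
    then show "\<forall>\<^sub>F d in at_right 0. x0 + d * ln (v i) \<in> X"
      using X(1) x0 by (rule topological_tendstoD)
  qed simp
  then have "\<forall>\<^sub>F d in at_right 0. d > 0 \<and> (\<forall>i\<in>{..<n}. x0 + d * ln (v i) \<in> X)"
    using eventually_at_right_less[of 0] by eventually_elim auto
  then obtain d where d: "d > 0" "\<And>i. i < n \<Longrightarrow> x0 + d * ln (v i) \<in> X"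
    using eventually_happens'[OF trivial_limit_at_right_real] by (metis (lifting) lessThan_iff)
  define x where "x = (\<lambda>i. x0 + d * ln (v i))"
  have x: "strict_mono_on {..<n} x" "x \<in> {..<n} \<rightarrow> X"
  proof -
    show "strict_mono_on {..<n} x"
    proof (rule strict_mono_onI)
      fix i j assume "i \<in> {..<n}" "j \<in> {..<n}" "i < j"
      then show "x i < x j"
        using strict_mono_onD[OF v(1), of i j] v(2) d(1) by (simp add: x_def)
    qed
  qed (use d in \<open>auto simp: x_def\<close>)
  \<comment> \<open>Constant and exponential together have rank at most two; the Gaussian summand
    makes the kernel totally positive for every \<open>e > 0\<close>, and continuity of
    \<open>F\<close> removes it as \<open>e\<close> tends to 0.\<close>
  define g where "g = (\<lambda>e m. (a + exp (2 * (1 / d * (m - x0)))) + e * exp (2 * (m - 0)\<^sup>2))"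
  define G where "G = (\<lambda>i j. exp (2 * ((x i + x j) / 2 - 0)\<^sup>2))"
  have g: "g e ((x i + x j) / 2) = a + v i * v j + e * G i j" if "i < n" "j < n" for i j e
  proof -
    have "2 * (1 / d * ((x i + x j) / 2 - x0)) = ln (v i) + ln (v j)"
      using d(1) by (simp add: x_def field_simps)
    then show ?thesis
      using v(2) that by (simp add: g_def G_def exp_add)
  qed
  have "0 \<le> (\<Sum>i<n. \<Sum>j<n. c i * c j * F (a + v i * v j + e * G i j))" if "e > 0" for e
  proof -
    have "hankel_pd X (g e)"
      unfolding g_def
      by (intro hankel_psd_add_pd hankel_psd_add hankel_psd_const hankel_psd_exp hankel_pd_gauss that less_imp_le a)
    moreover have "continuous_on X (g e)"
      unfolding g_def using d(1) by (intro continuous_intros) auto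
    ultimately have "hankel_psd X (\<lambda>m. F (g e m))"
      by (intro compose_hankel_kernel_TN_imp(2)[OF F[OF hankel_kernel_in_cont_TP]])
    from hankel_psdD[OF this x, of c] show ?thesis
      by (simp add: g)
  qed
  moreover have "(\<lambda>m. \<Sum>i<n. \<Sum>j<n. c i * c j * F (a + v i * v j + inverse (real (Suc m)) * G i j))
      \<longlonglongrightarrow> (\<Sum>i<n. \<Sum>j<n. c i * c j * F (a + v i * v j))"
  proof (intro tendsto_sum tendsto_mult tendsto_const)
    fix i j assume "i \<in> {..<n}" "j \<in> {..<n}"
    then have "a + v i * v j > 0"
      using a v(2) by (intro add_pos_pos mult_pos_pos) auto
    then have "isCont F (a + v i * v j)"
      using transform_continuous by (simp add: continuous_on_eq_continuous_at)
    moreover have "(\<lambda>m. a + v i * v j + inverse (real (Suc m)) * G i j) \<longlonglongrightarrow> a + v i * v j + 0 * G i j"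
      by (intro tendsto_intros LIMSEQ_inverse_real_of_nat)
    ultimately show "(\<lambda>m. F (a + v i * v j + inverse (real (Suc m)) * G i j)) \<longlonglongrightarrow> F (a + v i * v j)"
      by (intro isCont_tendsto_compose[of "a + v i * v j" F]) simp_all
  qed
  ultimately show "0 \<le> (\<Sum>i<n. \<Sum>j<n. c i * c j * F (a + v i * v j))"
    by (intro LIMSEQ_le_const) (auto intro!: exI[of _ 0])
qed

lemma transform_power_series:
  "\<exists>c. (\<forall>k. c k \<ge> 0) \<and> (\<forall>x>0. (\<lambda>k. c k * x ^ k) sums F x)"
  by (intro bernstein_absolutely_monotone transform_continuous
      rank_two_positive_forward_diff_nonneg transform_rank_two_positive)

end

end

lemma continuous_on_pos_power_series:
  fixes F :: "real \<Rightarrow> real"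
  assumes "\<And>x. x > 0 \<Longrightarrow> (\<lambda>k. c k * x ^ k) sums F x"
  shows "continuous_on {0<..} F"
proof -
  have "summable (\<lambda>k. c k * y ^ k)" for y
  proof (rule powser_inside)
    show "summable (\<lambda>k. c k * (\<bar>y\<bar> + 1) ^ k)"
      using sums_summable[OF assms[of "\<bar>y\<bar> + 1"]] by simp
  qed simp
  then have "isCont (\<lambda>x. \<Sum>k. c k * x ^ k) y" for y
    by (rule isCont_powser_converges_everywhere)
  then have "continuous_on {0<..} (\<lambda>x. \<Sum>k. c k * x ^ k)"
    by (intro continuous_at_imp_continuous_on) auto
  then show ?thesis
    by (rule continuous_on_cong[THEN iffD1, rotated -1]) (use assms in \<open>auto simp: sums_iff\<close>)
qed

theorem theorem1p3:
  fixes X :: "real set"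
  assumes "X \<noteq> {}" and "open X" and "is_interval X"
  shows
    "(\<forall>F :: real \<Rightarrow> real.
        (\<lambda>K. F \<circ> K) \<in> cont_TN_hankel_kernels X \<rightarrow> cont_TN_hankel_kernels X \<longleftrightarrow>
        F 0 \<ge> 0 \<and>
        (\<exists>c :: nat \<Rightarrow> real. (\<forall>k. c k \<ge> 0) \<and> (\<forall>x\<in>{0<..}. (\<lambda>k. c k * x ^ k) sums F x))) \<and>
     (\<forall>F :: real \<Rightarrow> real.
        (\<lambda>K. F \<circ> K) \<in> cont_TP_hankel_kernels X \<rightarrow> cont_TP_hankel_kernels X \<longleftrightarrow>
        \<not> F constant_on {0<..} \<and>
        (\<exists>c :: nat \<Rightarrow> real. (\<forall>k. c k \<ge> 0) \<and> (\<forall>x\<in>{0<..}. (\<lambda>k. c k * x ^ k) sums F x)))"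
proof -
  note X = assms(2,3) and nonempty = assms(1)
  have powser_continuous: "continuous_on X (\<lambda>m. F (g m))"
    if "continuous_on X g" "\<And>m. m \<in> X \<Longrightarrow> g m > 0"
      "\<And>x. x > 0 \<Longrightarrow> (\<lambda>k. c k * x ^ k) sums F x" for F g :: "real \<Rightarrow> real" and c
    using continuous_on_compose2[OF continuous_on_pos_power_series[of c F] that(1)] that by auto
  have TN: "(\<lambda>K. F \<circ> K) \<in> cont_TN_hankel_kernels X \<rightarrow> cont_TN_hankel_kernels X \<longleftrightarrow>
      F 0 \<ge> 0 \<and> (\<exists>c. (\<forall>k. c k \<ge> 0) \<and> (\<forall>x\<in>{0<..}. (\<lambda>k. c k * x ^ k) sums F x))" (is "?L \<longleftrightarrow> ?R") for F
  proof
    assume L: ?L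
    have "F \<circ> (\<lambda>(x, y). 0) \<in> cont_TN_hankel_kernels X"
      using L hankel_kernel_in_cont_TN[OF X nonempty, of "\<lambda>_. 0"] hankel_psd_const[of 0] by auto
    then have "hankel_psd X (\<lambda>_. F 0)"
      using compose_hankel_kernel_TN_imp(2)[OF X nonempty, of F "\<lambda>_. 0"] by simp
    then have "F 0 \<ge> 0"
      using hankel_psd_nonneg nonempty by blast
    moreover have "\<exists>c. (\<forall>k. c k \<ge> 0) \<and> (\<forall>x>0. (\<lambda>k. c k * x ^ k) sums F x)"
      by (rule transform_power_series[OF X nonempty])
        (use L cont_TP_subset_cont_TN[OF X nonempty] in blast)
    ultimately show ?R
      by auto
  next
    assume ?R
    then obtain c where F0: "F 0 \<ge> 0" and c: "\<And>k. c k \<ge> 0" "\<And>x. x > 0 \<Longrightarrow> (\<lambda>k. c k * x ^ k) sums F x"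
      by auto
    show ?L
    proof
      fix K assume "K \<in> cont_TN_hankel_kernels X"
      then obtain g where g: "continuous_on X g" "hankel_psd X g" "\<forall>x\<in>X. \<forall>y\<in>X. K (x, y) = g ((x + y) / 2)"
        unfolding cont_TN_hankel_kernels_iff[OF X] by blast
      have "continuous_on X (\<lambda>m. F (g m)) \<and> hankel_psd X (\<lambda>m. F (g m))"
      proof (cases "\<exists>p\<in>X. g p = 0")
        \<comment> \<open>Here \<open>g\<close> is zero on all of \<open>X\<close>, so the transform
          is the constant \<open>F 0\<close> and the series is not consulted.\<close>
        case True
        then have zero: "g q = 0" if "q \<in> X" for q
          using hankel_psd_zero_imp_zero[OF X nonempty g(2,1)] that by blast
        then have "continuous_on X (\<lambda>m. F (g m))"
          using continuous_on_cong[of X X "\<lambda>m. F (g m)" "\<lambda>_. F 0"] by simp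
        moreover have "hankel_psd X (\<lambda>m. F (g m))"
        proof -
          have "F (g ((x i + x j) / 2)) = F 0" if "x \<in> {..<n} \<rightarrow> X" "i < n" "j < n" for x i j and n :: nat
          proof -
            have "x i \<in> X" "x j \<in> X"
              using that by auto
            then show ?thesis
              using zero[OF midpoint_in_interval[OF X(2)]] by simp
          qed
          then show ?thesis
            using hankel_psd_const[OF F0, of X] unfolding hankel_psd_def by simp
        qed
        ultimately show ?thesis ..
      next
        case False
        then have pos: "g m > 0" if "m \<in> X" for m
          using hankel_psd_nonneg[OF g(2) that] that by (force simp: less_le)
        have "hankel_psd X (\<lambda>m. F (g m))"
          by (rule hankel_psd_power_series[OF X g(2,1), of c]) (use c pos in auto)
        then show ?thesis
          using powser_continuous[OF g(1) pos c(2)] by blast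
      qed
      then show "F \<circ> K \<in> cont_TN_hankel_kernels X"
        unfolding cont_TN_hankel_kernels_iff[OF X] using g(3) by (intro exI[of _ "\<lambda>m. F (g m)"]) simp
    qed
  qed
  have TP: "(\<lambda>K. F \<circ> K) \<in> cont_TP_hankel_kernels X \<rightarrow> cont_TP_hankel_kernels X \<longleftrightarrow>
      \<not> F constant_on {0<..} \<and> (\<exists>c. (\<forall>k. c k \<ge> 0) \<and> (\<forall>x\<in>{0<..}. (\<lambda>k. c k * x ^ k) sums F x))" (is "?L \<longleftrightarrow> ?R") for F
  proof
    assume L: ?L
    have "\<not> F constant_on {0<..}"
    proof
      assume "F constant_on {0<..}"
      then obtain e where e: "\<And>x. x > 0 \<Longrightarrow> F x = e"
        by (auto simp: constant_on_def)
      define g where "g = (\<lambda>m::real. exp (2 * (m - 0)\<^sup>2))"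
      have "(\<lambda>(x, y). g ((x + y) / 2)) \<in> cont_TP_hankel_kernels X"
        unfolding g_def by (intro hankel_kernel_in_cont_TP[OF X nonempty] hankel_pd_gauss continuous_intros)
      then have "F \<circ> (\<lambda>(x, y). g ((x + y) / 2)) \<in> cont_TP_hankel_kernels X"
        using L by blast
      then obtain h where h: "hankel_pd X h"
        "\<forall>x\<in>X. \<forall>y\<in>X. (F \<circ> (\<lambda>(x, y). g ((x + y) / 2))) (x, y) = h ((x + y) / 2)"
        unfolding cont_TP_hankel_kernels_iff[OF X] by blast
      have "h m = e" if "m \<in> X" for m
        using h(2)[rule_format, OF that that] e[of "g m"] by (simp add: g_def)
      then show False
        using hankel_pd_not_constant[OF h(1) X(1) nonempty] by (auto simp: constant_on_def)
    qed
    moreover have "\<exists>c. (\<forall>k. c k \<ge> 0) \<and> (\<forall>x>0. (\<lambda>k. c k * x ^ k) sums F x)"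
      by (rule transform_power_series[OF X nonempty])
        (use L cont_TP_subset_cont_TN[OF X nonempty] in blast)
    ultimately show ?R
      by auto
  next
    assume ?R
    then obtain c where nonconst: "\<not> F constant_on {0<..}"
      and c: "\<And>k. c k \<ge> 0" "\<And>x. x > 0 \<Longrightarrow> (\<lambda>k. c k * x ^ k) sums F x"
      by auto
    \<comment> \<open>A positive coefficient beyond the constant term: the corresponding power of a
      positive definite \<open>g\<close> keeps the whole series strictly positive definite.\<close>
    have "\<exists>k>0. c k > 0"
    proof (rule ccontr)
      assume "\<not> (\<exists>k>0. c k > 0)"
      then have zero: "c k = 0" if "k \<noteq> 0" for k
        using that c(1) by (metis gr0I order_le_less)
      have "F x = c 0" if "x > 0" for x
      proof -
        have "(\<lambda>k. c k * x ^ k) sums (\<Sum>k\<in>{0}. c k * x ^ k)"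
          by (rule sums_finite) (simp_all add: zero)
        then show ?thesis
          using sums_unique2[OF c(2)[OF that]] by simp
      qed
      then show False
        using nonconst by (auto simp: constant_on_def)
    qed
    then obtain k where k: "k > 0" "c k > 0"
      by blast
    show ?L
    proof
      fix K assume "K \<in> cont_TP_hankel_kernels X"
      then obtain g where g: "continuous_on X g" "hankel_pd X g" "\<forall>x\<in>X. \<forall>y\<in>X. K (x, y) = g ((x + y) / 2)"
        unfolding cont_TP_hankel_kernels_iff[OF X] by blast
      have "hankel_pd X (\<lambda>m. F (g m))"
        by (rule hankel_pd_power_series[OF X g(2,1), of c k]) (use c k hankel_pd_pos[OF g(2)] in auto)
      moreover have "continuous_on X (\<lambda>m. F (g m))"
        by (rule powser_continuous[OF g(1) hankel_pd_pos[OF g(2)] c(2)])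
      ultimately show "F \<circ> K \<in> cont_TP_hankel_kernels X"
        unfolding cont_TP_hankel_kernels_iff[OF X] using g(3) by (intro exI[of _ "\<lambda>m. F (g m)"]) simp
    qed
  qed
  show ?thesis
    using TN TP by blast
qed

end
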